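(* Let $\alpha>0$. Then the operator $(-\Delta)^{\alpha}$ on $\ell^2(\mathbb{N})$ is critical if and only if $\alpha\ge 3/2$.
   Context: $\mathbb{N}=\{1,2,3,\dots\}$. The discrete Laplacian on the half line is the bounded self-adjoint operator $-\Delta$ on $\ell^2(\mathbb{N})$ given by $(-\Delta u)_n := -u_{n-1}+2u_n-u_{n+1}$ for $n\in\mathbb{N}$, with the convention $u_0:=0$; its spectrum is $[0,4]$. For $\alpha>0$, the power $(-\Delta)^\alpha$ is defined by the functional calculus for self-adjoint operators. A potential is a diagonal operator $V$ on $\ell^2(\mathbb{N})$, identified with the real sequence $\{V_n\}_{n\in\mathbb{N}}$ of its diagonal entries; $V\le 0$ (resp. $V\geq 0$) means $V_n\le0$ (resp. $V_n\geq 0$) for all $n$, and non-trivial means not identically zero. A bounded self-adjoint operator $H$ on $\ell^2(\mathbb{N})$ is called critical if $\inf\sigma(H+V)<0$ for every non-trivial potential $V\le 0$. It is called subcritical if it is not critical; equivalently, if there is a non-trivial potential $V\ge0$ such that $H\ge V$ in the sense of forms, i.e. $\langle\psi,(H-V)\psi\rangle\ge0$ for all $\psi\in\ell^2(\mathbb{N})$. *)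

theory Defs
  imports "HOL-Analysis.Analysis" "HOL-Computational_Algebra.Polynomial"
begin

section \<open>The complex Hilbert space of square summable sequences on {1, 2, ...}\<close>

text \<open>Sequences are indexed by all of \<^typ>\<open>nat\<close>, but the entry at 0 is required to vanish. Thus the
  index set is really {1, 2, ...} and the convention \<open>u\<^sub>0 = 0\<close> is built in.\<close>

typedef ell2 = "{u :: nat \<Rightarrow> complex. u 0 = 0 \<and> summable (\<lambda>n. (cmod (u n))\<^sup>2)}"
  by (rule exI[of _ "\<lambda>_. 0"]) simp

setup_lifting type_definition_ell2

lemma ell2_0 [simp]: "Rep_ell2 u 0 = 0"
  by transfer simp

lemma ell2_summable: "summable (\<lambda>n. (cmod (Rep_ell2 u n))\<^sup>2)"
  by transfer simp

lemma cmod_add_sq_le: "(cmod (a + b))\<^sup>2 \<le> 2 * (cmod a)\<^sup>2 + 2 * (cmod b)\<^sup>2"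
proof -
  have "(cmod (a + b))\<^sup>2 \<le> (cmod a + cmod b)\<^sup>2"
    by (intro power_mono norm_triangle_ineq norm_ge_zero)
  also have "\<dots> \<le> 2 * (cmod a)\<^sup>2 + 2 * (cmod b)\<^sup>2"
    using zero_le_power2[of "cmod a - cmod b"] by (simp add: power2_eq_square algebra_simps)
  finally show ?thesis .
qed

lemma sq_summable_add:
  fixes f g :: "nat \<Rightarrow> complex"
  assumes "summable (\<lambda>n. (cmod (f n))\<^sup>2)" "summable (\<lambda>n. (cmod (g n))\<^sup>2)"
  shows "summable (\<lambda>n. (cmod (f n + g n))\<^sup>2)"
  by (rule summable_comparison_test'[where g = "\<lambda>n. 2 * (cmod (f n))\<^sup>2 + 2 * (cmod (g n))\<^sup>2" and N = 0])
     (use assms cmod_add_sq_le in \<open>auto intro!: summable_add summable_mult\<close>)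

lemma sq_summable_scale:
  fixes f :: "nat \<Rightarrow> complex"
  assumes "summable (\<lambda>n. (cmod (f n))\<^sup>2)"
  shows "summable (\<lambda>n. (cmod (c * f n))\<^sup>2)"
  using summable_mult[OF assms, of "(cmod c)\<^sup>2"] by (simp add: norm_mult power_mult_distrib)

lemma sq_summable_mult:
  fixes f g :: "nat \<Rightarrow> complex"
  assumes "summable (\<lambda>n. (cmod (f n))\<^sup>2)" "summable (\<lambda>n. (cmod (g n))\<^sup>2)"
  shows "summable (\<lambda>n. cnj (f n) * g n)"
proof (rule summable_norm_cancel, rule summable_comparison_test'[where g = "\<lambda>n. (cmod (f n))\<^sup>2 + (cmod (g n))\<^sup>2" and N = 0])
  show "summable (\<lambda>n. (cmod (f n))\<^sup>2 + (cmod (g n))\<^sup>2)"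
    by (rule summable_add[OF assms])
  fix n
  have "2 * (cmod (f n) * cmod (g n)) \<le> (cmod (f n))\<^sup>2 + (cmod (g n))\<^sup>2"
    using zero_le_power2[of "cmod (f n) - cmod (g n)"] by (simp add: power2_eq_square algebra_simps)
  moreover have "0 \<le> cmod (f n) * cmod (g n)" by simp
  ultimately show "norm (norm (cnj (f n) * g n)) \<le> (cmod (f n))\<^sup>2 + (cmod (g n))\<^sup>2"
    unfolding norm_mult complex_mod_cnj real_norm_def by linarith
qed

instantiation ell2 :: real_vector
begin
lift_definition zero_ell2 :: ell2 is "\<lambda>_. 0" by simp
lift_definition plus_ell2 :: "ell2 \<Rightarrow> ell2 \<Rightarrow> ell2" is "\<lambda>u v n. u n + v n"
  by (auto intro: sq_summable_add)
lift_definition uminus_ell2 :: "ell2 \<Rightarrow> ell2" is "\<lambda>u n. - u n" by simp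
lift_definition minus_ell2 :: "ell2 \<Rightarrow> ell2 \<Rightarrow> ell2" is "\<lambda>u v n. u n - v n"
  using sq_summable_add[where g = "\<lambda>n. - g n" for g] by auto
lift_definition scaleR_ell2 :: "real \<Rightarrow> ell2 \<Rightarrow> ell2" is "\<lambda>c u n. complex_of_real c * u n"
  by (auto intro: sq_summable_scale)
instance
  by standard (transfer; simp add: algebra_simps fun_eq_iff)+
end

lift_definition cscale :: "complex \<Rightarrow> ell2 \<Rightarrow> ell2" is "\<lambda>c u n. c * u n"
  by (auto intro: sq_summable_scale)

lift_definition cinner :: "ell2 \<Rightarrow> ell2 \<Rightarrow> complex" is "\<lambda>u v. \<Sum>n. cnj (u n) * v n" .

lemma cinner_sums: "(\<lambda>n. cnj (Rep_ell2 u n) * Rep_ell2 v n) sums cinner u v"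
  unfolding cinner.rep_eq
  by (intro summable_sums sq_summable_mult ell2_summable)

lemma cinner_add_left: "cinner (u + v) w = cinner u w + cinner v w"
  by (rule sums_unique2[OF cinner_sums])
     (use sums_add[OF cinner_sums[of u w] cinner_sums[of v w]] in
      \<open>simp add: plus_ell2.rep_eq algebra_simps\<close>)

lemma cinner_cscale_right: "cinner u (cscale c v) = c * cinner u v"
  by (rule sums_unique2[OF cinner_sums])
     (use sums_mult[OF cinner_sums[of u v], of c] in \<open>simp add: cscale.rep_eq algebra_simps\<close>)

lemma cinner_commute: "cinner u v = cnj (cinner v u)"
proof (rule sums_unique2[OF cinner_sums])
  have "(\<lambda>n. cnj (cnj (Rep_ell2 v n) * Rep_ell2 u n)) sums cnj (cinner v u)"
    using cinner_sums[of v u] by (simp only: sums_cnj)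
  then show "(\<lambda>n. cnj (Rep_ell2 u n) * Rep_ell2 v n) sums cnj (cinner v u)"
    by (simp add: mult.commute)
qed

lemma scaleR_ell2_cscale: "r *\<^sub>R (u :: ell2) = cscale (complex_of_real r) u"
  by transfer simp

lemma cinner_self: "(\<lambda>n. (cmod (Rep_ell2 u n))\<^sup>2) sums Re (cinner u u)"
proof -
  have "(cmod z)\<^sup>2 = Re (cnj z * z)" for z
    by (simp only: cmod_power2) (simp add: power2_eq_square)
  then show ?thesis
    using sums_Re[OF cinner_sums[of u u]] by (simp only:)
qed

instantiation ell2 :: real_inner
begin
definition inner_ell2 :: "ell2 \<Rightarrow> ell2 \<Rightarrow> real" where
  "inner_ell2 u v = Re (cinner u v)"
definition norm_ell2 :: "ell2 \<Rightarrow> real" where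
  "norm_ell2 u = sqrt (\<Sum>n. (cmod (Rep_ell2 u n))\<^sup>2)"
definition dist_ell2 :: "ell2 \<Rightarrow> ell2 \<Rightarrow> real" where
  "dist_ell2 u v = norm (u - v)"
definition sgn_ell2 :: "ell2 \<Rightarrow> ell2" where
  "sgn_ell2 u = inverse (norm u) *\<^sub>R u"
definition uniformity_ell2 :: "(ell2 \<times> ell2) filter" where
  "uniformity_ell2 = (INF e\<in>{0<..}. principal {(u, v). dist u v < e})"
definition open_ell2 :: "ell2 set \<Rightarrow> bool" where
  "open_ell2 U = (\<forall>u\<in>U. eventually (\<lambda>(u', v). u' = u \<longrightarrow> v \<in> U) uniformity)"
instance
proof
  fix u v w :: ell2 and r :: real and U :: "ell2 set"
  show "dist u v = norm (u - v)" by (rule dist_ell2_def)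
  show "sgn u = u /\<^sub>R norm u" by (simp add: sgn_ell2_def)
  show "(uniformity :: (ell2 \<times> ell2) filter) = (INF e\<in>{0<..}. principal {(x, y). dist x y < e})"
    by (rule uniformity_ell2_def)
  show "open U \<longleftrightarrow> (\<forall>x\<in>U. \<forall>\<^sub>F (x', y) in uniformity. x' = x \<longrightarrow> y \<in> U)"
    by (rule open_ell2_def)
  show "inner u v = inner v u"
    unfolding inner_ell2_def by (subst cinner_commute) simp
  show "inner (u + v) w = inner u w + inner v w"
    by (simp add: inner_ell2_def cinner_add_left)
  show "inner (r *\<^sub>R u) v = r * inner u v"
    unfolding inner_ell2_def scaleR_ell2_cscale
    by (subst (1 2) cinner_commute) (simp add: cinner_cscale_right)
  show "0 \<le> inner u u"
    unfolding inner_ell2_def by (rule sums_le[OF _ sums_zero cinner_self]) simp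
  show "norm u = sqrt (inner u u)"
    unfolding inner_ell2_def norm_ell2_def using sums_unique[OF cinner_self[of u]] by simp
  show "inner u u = 0 \<longleftrightarrow> u = 0"
  proof
    assume "inner u u = 0"
    then have "(\<Sum>n. (cmod (Rep_ell2 u n))\<^sup>2) = 0"
      unfolding inner_ell2_def using sums_unique[OF cinner_self[of u]] by simp
    then have "\<forall>n. (cmod (Rep_ell2 u n))\<^sup>2 = 0"
      using suminf_eq_zero_iff[OF ell2_summable] by simp
    then show "u = 0"
      by (simp add: Rep_ell2_inject[symmetric] zero_ell2.rep_eq fun_eq_iff)
  next
    assume "u = 0"
    then show "inner u u = 0"
      by (simp add: inner_ell2_def cinner.rep_eq zero_ell2.rep_eq)
  qed
qed
end

lemma ell2_norm_sq: "(norm u)\<^sup>2 = (\<Sum>n. (cmod (Rep_ell2 u n))\<^sup>2)"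
  unfolding norm_ell2_def by (simp add: suminf_nonneg ell2_summable)

lemma sum_le_ell2_norm_sq: "(\<Sum>k<K. (cmod (Rep_ell2 u k))\<^sup>2) \<le> (norm u)\<^sup>2"
  unfolding ell2_norm_sq by (intro sum_le_suminf ell2_summable) auto

lemma cmod_le_ell2_norm: "cmod (Rep_ell2 u k) \<le> norm u"
proof (rule power2_le_imp_le)
  have "(cmod (Rep_ell2 u k))\<^sup>2 \<le> (\<Sum>k<Suc k. (cmod (Rep_ell2 u k))\<^sup>2)"
    by (simp add: sum_nonneg)
  then show "(cmod (Rep_ell2 u k))\<^sup>2 \<le> (norm u)\<^sup>2"
    using sum_le_ell2_norm_sq[of u "Suc k"] by linarith
qed simp

instance ell2 :: complete_space
proof
  fix X :: "nat \<Rightarrow> ell2"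
  assume X: "Cauchy X"
  define x where "x k = lim (\<lambda>n. Rep_ell2 (X n) k)" for k
  have lim: "(\<lambda>n. Rep_ell2 (X n) k) \<longlonglongrightarrow> x k" for k
  proof -
    have "Cauchy (\<lambda>n. Rep_ell2 (X n) k)"
    proof (rule metric_CauchyI)
      fix e :: real assume "0 < e"
      then obtain M where M: "\<forall>m\<ge>M. \<forall>n\<ge>M. dist (X m) (X n) < e"
        using X unfolding Cauchy_def by blast
      have "dist (Rep_ell2 (X m) k) (Rep_ell2 (X n) k) \<le> dist (X m) (X n)" for m n
        using cmod_le_ell2_norm[of "X m - X n" k] by (simp add: dist_norm minus_ell2.rep_eq)
      then show "\<exists>M. \<forall>m\<ge>M. \<forall>n\<ge>M. dist (Rep_ell2 (X m) k) (Rep_ell2 (X n) k) < e"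
        using M by (meson le_less_trans)
    qed
    then show ?thesis
      unfolding x_def using Cauchy_convergent convergent_LIMSEQ_iff by blast
  qed
  have x0: "x 0 = 0"
    using lim[of 0] by (simp add: LIMSEQ_const_iff)
  have tail: "\<exists>M. \<forall>m\<ge>M. \<forall>K. (\<Sum>k<K. (cmod (Rep_ell2 (X m) k - x k))\<^sup>2) \<le> e\<^sup>2" if e: "0 < e" for e :: real
  proof -
    obtain M where M: "\<forall>m\<ge>M. \<forall>n\<ge>M. dist (X m) (X n) < e"
      using X e unfolding Cauchy_def by blast
    have "(\<Sum>k<K. (cmod (Rep_ell2 (X m) k - x k))\<^sup>2) \<le> e\<^sup>2" if m: "m \<ge> M" for m K
    proof (rule LIMSEQ_le_const2)
      show "(\<lambda>n. \<Sum>k<K. (cmod (Rep_ell2 (X m) k - Rep_ell2 (X n) k))\<^sup>2)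
          \<longlonglongrightarrow> (\<Sum>k<K. (cmod (Rep_ell2 (X m) k - x k))\<^sup>2)"
        by (intro tendsto_intros lim)
      show "\<exists>N. \<forall>n\<ge>N. (\<Sum>k<K. (cmod (Rep_ell2 (X m) k - Rep_ell2 (X n) k))\<^sup>2) \<le> e\<^sup>2"
      proof (intro exI allI impI)
        fix n assume n: "n \<ge> M"
        have "(norm (X m - X n))\<^sup>2 \<le> e\<^sup>2"
          using M m n by (intro power_mono) (auto simp: dist_norm intro: less_imp_le)
        then show "(\<Sum>k<K. (cmod (Rep_ell2 (X m) k - Rep_ell2 (X n) k))\<^sup>2) \<le> e\<^sup>2"
          using sum_le_ell2_norm_sq[of "X m - X n" K] by (simp add: minus_ell2.rep_eq)
      qed
    qed
    then show ?thesis by blast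
  qed
  have sq: "summable (\<lambda>k. (cmod (x k))\<^sup>2)"
  proof -
    obtain M where M: "\<forall>m\<ge>M. \<forall>K. (\<Sum>k<K. (cmod (Rep_ell2 (X m) k - x k))\<^sup>2) \<le> 1\<^sup>2"
      using tail[of 1] by auto
    have "summable (\<lambda>k. (cmod (Rep_ell2 (X M) k - x k))\<^sup>2)"
      by (rule summableI_nonneg_bounded[where x = "1\<^sup>2"]) (use M in auto)
    then have "summable (\<lambda>k. (cmod (x k - Rep_ell2 (X M) k))\<^sup>2)"
      by (simp add: norm_minus_commute)
    from sq_summable_add[OF this ell2_summable[of "X M"]] show ?thesis by simp
  qed
  define L where "L = Abs_ell2 x"
  have L: "Rep_ell2 L = x"
    unfolding L_def using x0 sq by (simp add: Abs_ell2_inverse)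
  have "X \<longlonglongrightarrow> L"
  proof (rule metric_LIMSEQ_I)
    fix r :: real assume r: "0 < r"
    then obtain M where M: "\<forall>m\<ge>M. \<forall>K. (\<Sum>k<K. (cmod (Rep_ell2 (X m) k - x k))\<^sup>2) \<le> (r / 2)\<^sup>2"
      using tail[of "r / 2"] by auto
    have "dist (X m) L < r" if m: "m \<ge> M" for m
    proof -
      have "(norm (X m - L))\<^sup>2 \<le> (r / 2)\<^sup>2"
        unfolding ell2_norm_sq by (rule suminf_le_const[OF ell2_summable])
          (use M m in \<open>simp add: minus_ell2.rep_eq L\<close>)
      then have "norm (X m - L) \<le> r / 2"
        by (rule power2_le_imp_le) (use r in simp)
      then show ?thesis using r by (simp add: dist_norm)
    qed
    then show "\<exists>M. \<forall>m\<ge>M. dist (X m) L < r" by blast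
  qed
  then show "convergent X" by (rule convergentI)
qed

instance ell2 :: banach ..

section \<open>Bounded operators, potentials and spectra\<close>

text \<open>\<^typ>\<open>ell2 \<Rightarrow>\<^sub>L ell2\<close> is the space of bounded real-linear operators with the operator norm. The
  condition below forces complex linearity.\<close>

definition selfadjoint :: "(ell2 \<Rightarrow>\<^sub>L ell2) \<Rightarrow> bool" where
  "selfadjoint A \<longleftrightarrow> (\<forall>u v. cinner (blinfun_apply A u) v = cinner u (blinfun_apply A v))"

text \<open>The spectrum of a complex-linear, possibly unbounded operator \<open>T\<close> with domain \<open>D\<close>: the
  complement of the set of \<open>z\<close> for which \<open>T - z : D \<rightarrow> \<ell>\<^sup>2\<close> has a bounded everywhere defined
  inverse \<open>R\<close>.\<close>

definition spectrum_on :: "ell2 set \<Rightarrow> (ell2 \<Rightarrow> ell2) \<Rightarrow> complex set" where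
  "spectrum_on D T = {z. \<not> (\<exists>R :: ell2 \<Rightarrow>\<^sub>L ell2.
     (\<forall>v. blinfun_apply R v \<in> D \<and> T (blinfun_apply R v) - cscale z (blinfun_apply R v) = v) \<and>
     (\<forall>u\<in>D. blinfun_apply R (T u - cscale z u) = u))}"

text \<open>For self-adjoint operators the spectrum is real, so nothing is lost by passing to its real
  points.\<close>

definition real_spectrum_on :: "ell2 set \<Rightarrow> (ell2 \<Rightarrow> ell2) \<Rightarrow> real set" where
  "real_spectrum_on D T = {x. complex_of_real x \<in> spectrum_on D T}"

text \<open>A potential is an arbitrary real sequence on {1, 2, ...} (the value at 0 plays no role, as all
  \<open>u\<close> in \<open>\<ell>\<^sup>2\<close> vanish there), acting by multiplication on its maximal domain; it need not be
  bounded.\<close>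

definition pot_domain :: "(nat \<Rightarrow> real) \<Rightarrow> ell2 set" where
  "pot_domain V = {u. summable (\<lambda>n. (cmod (complex_of_real (V n) * Rep_ell2 u n))\<^sup>2)}"

definition pot_op :: "(nat \<Rightarrow> real) \<Rightarrow> ell2 \<Rightarrow> ell2" where
  "pot_op V u = Abs_ell2 (\<lambda>n. complex_of_real (V n) * Rep_ell2 u n)"

lemma pot_op_apply:
  assumes "u \<in> pot_domain V"
  shows "Rep_ell2 (pot_op V u) n = complex_of_real (V n) * Rep_ell2 u n"
  using assms unfolding pot_op_def pot_domain_def by (subst Abs_ell2_inverse) auto

text \<open>The infimum is taken in the extended reals; for unbounded \<open>V \<le> 0\<close> it is \<open>-\<infinity>\<close>.\<close>

definition critical :: "(ell2 \<Rightarrow>\<^sub>L ell2) \<Rightarrow> bool" where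
  "critical H \<longleftrightarrow> selfadjoint H \<and>
     (\<forall>V :: nat \<Rightarrow> real. (\<forall>n\<ge>1. V n \<le> 0) \<and> (\<exists>n\<ge>1. V n \<noteq> 0) \<longrightarrow>
        (INF x\<in>real_spectrum_on (pot_domain V) (\<lambda>u. blinfun_apply H u + pot_op V u). ereal x) < 0)"

section \<open>The continuous functional calculus\<close>

definition blinfun_poly :: "real poly \<Rightarrow> (ell2 \<Rightarrow>\<^sub>L ell2) \<Rightarrow> (ell2 \<Rightarrow>\<^sub>L ell2)" where
  "blinfun_poly p A = (\<Sum>i\<le>degree p. coeff p i *\<^sub>R (((\<lambda>B. A o\<^sub>L B) ^^ i) id_blinfun))"

text \<open>For self-adjoint \<open>A\<close> and real-valued \<open>f\<close> continuous on the spectrum of \<open>A\<close>, the operator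
  \<open>f(A)\<close> is the operator-norm limit of \<open>p\<^sub>n(A)\<close> for any polynomials \<open>p\<^sub>n\<close> that converge to \<open>f\<close>
  uniformly on the spectrum (such \<open>p\<^sub>n\<close> exist by Weierstrass).\<close>

definition fun_calc :: "(real \<Rightarrow> real) \<Rightarrow> (ell2 \<Rightarrow>\<^sub>L ell2) \<Rightarrow> (ell2 \<Rightarrow>\<^sub>L ell2)" where
  "fun_calc f A = (THE B. \<forall>p :: nat \<Rightarrow> real poly.
     uniform_limit (real_spectrum_on UNIV (blinfun_apply A)) (\<lambda>n x. poly (p n) x) f sequentially \<longrightarrow>
     (\<lambda>n. blinfun_poly (p n) A) \<longlonglongrightarrow> B)"

section \<open>The discrete Laplacian on the half line\<close>

lemma sq_summable_Suc:
  fixes u :: "nat \<Rightarrow> complex"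
  shows "summable (\<lambda>n. (cmod (u (n + 1)))\<^sup>2) \<longleftrightarrow> summable (\<lambda>n. (cmod (u n))\<^sup>2)"
  using summable_Suc_iff[of "\<lambda>n. (cmod (u n))\<^sup>2"] by simp

lift_definition shift_left :: "ell2 \<Rightarrow> ell2" is "\<lambda>u n. if n = 0 then 0 else u (n + 1)"
proof -
  fix u :: "nat \<Rightarrow> complex"
  assume "u 0 = 0 \<and> summable (\<lambda>n. (cmod (u n))\<^sup>2)"
  then have "summable (\<lambda>n. (cmod (u (n + 1)))\<^sup>2)"
    by (simp only: sq_summable_Suc)
  then show "(if (0::nat) = 0 then 0 else u (0 + 1)) = 0 \<and>
      summable (\<lambda>n. (cmod (if n = 0 then 0 else u (n + 1)))\<^sup>2)"
    by (auto elim!: summable_comparison_test'[where N = 0])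
qed

lift_definition shift_right :: "ell2 \<Rightarrow> ell2" is "\<lambda>u n. if n = 0 then 0 else u (n - 1)"
  by (subst sq_summable_Suc[symmetric]) simp

lift_definition neg_laplacian_fun :: "ell2 \<Rightarrow> ell2" is
  "\<lambda>u n. if n = 0 then 0 else - u (n - 1) + 2 * u n - u (n + 1)"
proof -
  fix u :: "nat \<Rightarrow> complex"
  assume *: "u 0 = 0 \<and> summable (\<lambda>n. (cmod (u n))\<^sup>2)"
  let ?U = "Abs_ell2 u"
  have "Rep_ell2 ?U = u"
    using * by (simp add: Abs_ell2_inverse)
  then have "Rep_ell2 (2 *\<^sub>R ?U - shift_right ?U - shift_left ?U) =
      (\<lambda>n. if n = 0 then 0 else - u (n - 1) + 2 * u n - u (n + 1))"
    using * by (auto simp: fun_eq_iff minus_ell2.rep_eq scaleR_ell2.rep_eq shift_left.rep_eq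
        shift_right.rep_eq)
  then show "(if (0::nat) = 0 then 0 else - u (0 - 1) + 2 * u 0 - u (0 + 1)) = 0 \<and>
      summable (\<lambda>n. (cmod (if n = 0 then 0 else - u (n - 1) + 2 * u n - u (n + 1)))\<^sup>2)"
    using ell2_summable[of "2 *\<^sub>R ?U - shift_right ?U - shift_left ?U"] by simp
qed

lemma neg_laplacian_fun_shift: "neg_laplacian_fun u = 2 *\<^sub>R u - shift_right u - shift_left u"
  by (auto simp: Rep_ell2_inject[symmetric] fun_eq_iff minus_ell2.rep_eq scaleR_ell2.rep_eq
      shift_left.rep_eq shift_right.rep_eq neg_laplacian_fun.rep_eq)

lemma norm_shift_left_le: "norm (shift_left u) \<le> norm u"
proof -
  have s: "summable (\<lambda>n. (cmod (Rep_ell2 u (n + 1)))\<^sup>2)"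
    by (simp only: sq_summable_Suc ell2_summable)
  have "(\<Sum>n. (cmod (Rep_ell2 (shift_left u) n))\<^sup>2) \<le> (\<Sum>n. (cmod (Rep_ell2 u (n + 1)))\<^sup>2)"
    by (rule suminf_le[OF _ ell2_summable s]) (simp add: shift_left.rep_eq)
  also have "\<dots> = (\<Sum>n. (cmod (Rep_ell2 u n))\<^sup>2)"
    using suminf_split_head[OF ell2_summable[of u]] by simp
  finally show ?thesis
    by (simp add: norm_ell2_def)
qed

lemma norm_shift_right: "norm (shift_right u) = norm u"
  using suminf_split_head[OF ell2_summable[of "shift_right u"]]
  by (simp add: norm_ell2_def shift_right.rep_eq)

lift_definition neg_laplacian :: "ell2 \<Rightarrow>\<^sub>L ell2" is neg_laplacian_fun
proof (rule bounded_linear_intro[where K = 4])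
  fix u v :: ell2 and r :: real
  show "neg_laplacian_fun (u + v) = neg_laplacian_fun u + neg_laplacian_fun v"
    by (transfer; simp add: fun_eq_iff algebra_simps)
  show "neg_laplacian_fun (r *\<^sub>R u) = r *\<^sub>R neg_laplacian_fun u"
    by (transfer; simp add: fun_eq_iff algebra_simps)
  have "norm (neg_laplacian_fun u) \<le> norm (2 *\<^sub>R u) + norm (shift_right u) + norm (shift_left u)"
    unfolding neg_laplacian_fun_shift
    using norm_triangle_ineq4[of "2 *\<^sub>R u - shift_right u" "shift_left u"]
      norm_triangle_ineq4[of "2 *\<^sub>R u" "shift_right u"] by linarith
  then show "norm (neg_laplacian_fun u) \<le> norm u * 4"
    using norm_shift_left_le[of u] norm_shift_right[of u] by simp
qed

definition frac_laplacian :: "real \<Rightarrow> (ell2 \<Rightarrow>\<^sub>L ell2)" where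
  "frac_laplacian \<alpha> = fun_calc (\<lambda>x. x powr \<alpha>) neg_laplacian"

end

theory Submission
  imports Defs
begin

text \<open>Let \<open>A\<close> be the Laplacian. The sine transform \<open>u \<mapsto> \<Sum>k. u\<^sub>k sin (k \<theta>)\<close> on \<open>[0, \<pi>]\<close> turns \<open>A\<close> into
  multiplication by the symbol \<open>2 - 2 cos \<theta>\<close> and is, up to a constant, an isometry (\<open>parseval\<close>,
  \<open>sine_transform_neg_laplacian\<close>). Hence the energy of \<open>u\<close> for \<open>A\<^sup>\<alpha>\<close> is a constant times the integral of
  \<open>symbol\<^sup>\<alpha>\<close> against the squared modulus of the transform of \<open>u\<close> (\<open>frac_laplacian_form\<close>). That the
  functional calculus really produces such an operator rests on the norm bound \<open>norm_poly_diff_le\<close> for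
  polynomials of \<open>A\<close> and on the spectrum of \<open>A\<close> lying between \<open>(0, 4)\<close> and \<open>[0, 4]\<close>.

  Up to a constant, the entry \<open>u\<^sub>n\<close> is the integral of the transform against \<open>sin (n \<theta>)\<close>. By duality, a Hardy inequality
  \<open>c \<bar>u\<^sub>n\<bar>\<^sup>2 \<le> \<langle>u, A\<^sup>\<alpha> u\<rangle>\<close> holds for some \<open>c > 0\<close> if and only if \<open>sin\<^sup>2 (n \<theta>) / symbol\<^sup>\<alpha>\<close> is integrable.
  Near \<open>0\<close> this function behaves like \<open>\<theta>\<close> to the power \<open>2 - 2 \<alpha>\<close>, so it is integrable precisely for
  \<open>\<alpha> < 3/2\<close>.

  For \<open>\<alpha> < 3/2\<close> the Hardy inequality at the site 1 (\<open>frac_laplacian_hardy\<close>) shows that \<open>A\<^sup>\<alpha> - c \<delta>\<^sub>1\<close> is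
  nonnegative, hence without negative spectrum (\<open>not_criticalI\<close>).

  For \<open>\<alpha> \<ge> 3/2\<close> the Hardy inequality fails at every site, and it already fails on finitely supported
  sequences (\<open>frac_laplacian_small_energy\<close>): the extremal functions \<open>sin (n \<theta>) / (symbol\<^sup>\<alpha> + \<delta>)\<close> are
  approximated by transforms of \<open>q(A) \<delta>\<^sub>n\<close> with polynomials \<open>q\<close>. So any nontrivial \<open>V \<le> 0\<close> makes the form of
  \<open>A\<^sup>\<alpha> + V\<close> negative on some finitely supported sequence, and a symmetric operator with a negative form
  value has negative spectrum (\<open>negative_form_imp_negative_spectrum\<close>); this covers unbounded \<open>V\<close> too.\<close>

section \<open>Finitely supported sequences\<close>

lemma ell2_inner_sums: "(\<lambda>k. inner (Rep_ell2 u k) (Rep_ell2 v k)) sums inner u v"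
proof -
  have "inner a b = Re (cnj a * b)" for a b :: complex
    by (simp add: inner_complex_def)
  then show ?thesis
    using sums_Re[OF cinner_sums[of u v]] by (simp add: inner_ell2_def)
qed

lemma cinner_eq_inner: "cinner u v = Complex (inner u v) (inner u (cscale (- \<i>) v))"
  by (rule complex_eqI) (simp_all add: inner_ell2_def cinner_cscale_right)

definition finsupp :: "ell2 \<Rightarrow> bool" where
  "finsupp u \<longleftrightarrow> (\<exists>N. \<forall>k\<ge>N. Rep_ell2 u k = 0)"

lemma finsuppE:
  assumes "finsupp u" "finsupp v"
  obtains N where "\<And>k. k \<ge> N \<Longrightarrow> Rep_ell2 u k = 0" "\<And>k. k \<ge> N \<Longrightarrow> Rep_ell2 v k = 0"
proof -
  obtain M N where "\<forall>k\<ge>M. Rep_ell2 u k = 0" "\<forall>k\<ge>N. Rep_ell2 v k = 0"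
    using assms unfolding finsupp_def by blast
  then show ?thesis
    by (intro that[of "max M N"]) auto
qed

lemma finsupp_0 [simp]: "finsupp 0"
  by (simp add: finsupp_def zero_ell2.rep_eq)

lemma finsupp_add: "finsupp u \<Longrightarrow> finsupp v \<Longrightarrow> finsupp (u + v)"
  by (erule (1) finsuppE) (metis finsupp_def plus_ell2.rep_eq add_0)

lemma finsupp_diff: "finsupp u \<Longrightarrow> finsupp v \<Longrightarrow> finsupp (u - v)"
  by (erule (1) finsuppE) (metis finsupp_def minus_ell2.rep_eq diff_self)

lemma finsupp_scaleR: "finsupp u \<Longrightarrow> finsupp (c *\<^sub>R u)"
  by (auto simp: finsupp_def scaleR_ell2.rep_eq)

lemma finsupp_sum: "(\<And>i. i \<in> I \<Longrightarrow> finsupp (f i)) \<Longrightarrow> finsupp (sum f I)"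
  by (induction I rule: infinite_finite_induct) (auto intro: finsupp_add)

lift_definition trunc :: "nat \<Rightarrow> ell2 \<Rightarrow> ell2" is "\<lambda>N u k. if k < N then u k else 0"
  by (auto elim!: summable_comparison_test'[where N = 0])

lemma finsupp_trunc: "finsupp (trunc N u)"
  unfolding finsupp_def trunc.rep_eq by (rule exI[of _ N]) auto

lemma trunc_LIMSEQ: "(\<lambda>N. trunc N u) \<longlonglongrightarrow> u"
proof -
  have fin: "(\<lambda>k. if k < N then g k else 0) sums (\<Sum>k<N. g k)" for N and g :: "nat \<Rightarrow> real"
    using sums_If_finite_set[of "{..<N}" g] by simp
  have *: "inner (trunc N u) u = (\<Sum>k<N. (cmod (Rep_ell2 u k))\<^sup>2)"
      "inner (trunc N u) (trunc N u) = (\<Sum>k<N. (cmod (Rep_ell2 u k))\<^sup>2)" for N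
    by (rule sums_unique2[OF ell2_inner_sums],
        use fin[of N "\<lambda>k. (cmod (Rep_ell2 u k))\<^sup>2"] in
        \<open>simp add: trunc.rep_eq power2_norm_eq_inner if_distrib[of "\<lambda>x. inner x _"]
          if_distrib[of "inner _"] cong: if_cong\<close>)+
  have "(norm (trunc N u - u))\<^sup>2 = inner u u - (\<Sum>k<N. (cmod (Rep_ell2 u k))\<^sup>2)" for N
    using *[of N] by (simp add: power2_norm_eq_inner inner_diff_left inner_diff_right inner_commute)
  moreover have "(\<lambda>N. inner u u - (\<Sum>k<N. (cmod (Rep_ell2 u k))\<^sup>2)) \<longlonglongrightarrow> inner u u - inner u u"
    using cinner_self[of u] unfolding sums_def inner_ell2_def by (intro tendsto_intros)
  ultimately have "(\<lambda>N. (norm (trunc N u - u))\<^sup>2) \<longlonglongrightarrow> 0"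
    by simp
  from tendsto_real_sqrt[OF this] have "(\<lambda>N. norm (trunc N u - u)) \<longlonglongrightarrow> 0"
    by simp
  then show ?thesis
    using LIM_zero_iff tendsto_norm_zero_iff by blast
qed

text \<open>Finitely supported sequences are dense. On them all sums are finite, so that sums and integrals
  may be interchanged.\<close>

lemma le_by_finsupp:
  fixes f g :: "ell2 \<Rightarrow> real"
  assumes "\<And>u. finsupp u \<Longrightarrow> f u \<le> g u"
    and "\<And>X u. X \<longlonglongrightarrow> u \<Longrightarrow> (\<lambda>n. f (X n)) \<longlonglongrightarrow> f u" "\<And>X u. X \<longlonglongrightarrow> u \<Longrightarrow> (\<lambda>n. g (X n)) \<longlonglongrightarrow> g u"
  shows "f u \<le> g u"
  using assms(2,3)[OF trunc_LIMSEQ, of u] assms(1)[OF finsupp_trunc]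
  by (intro LIMSEQ_le) auto

section \<open>The sine transform\<close>

text \<open>The transform is only ever applied to finitely supported sequences, for which the series is a
  trigonometric polynomial and no convergence question arises.\<close>

definition sine_transform :: "ell2 \<Rightarrow> real \<Rightarrow> complex" where
  "sine_transform u \<theta> = (\<Sum>k. sin (real k * \<theta>) *\<^sub>R Rep_ell2 u k)"

lemma sine_transform_eq_sum:
  assumes "\<And>k. k \<ge> N \<Longrightarrow> Rep_ell2 u k = 0"
  shows "sine_transform u \<theta> = (\<Sum>k<N. sin (real k * \<theta>) *\<^sub>R Rep_ell2 u k)"
  unfolding sine_transform_def by (rule suminf_finite) (use assms in auto)

lemma sine_transform_sums:
  assumes "finsupp u"
  shows "(\<lambda>k. sin (real k * \<theta>) *\<^sub>R Rep_ell2 u k) sums sine_transform u \<theta>"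
proof -
  obtain N where "\<And>k. k \<ge> N \<Longrightarrow> Rep_ell2 u k = 0"
    using assms finsuppE by metis
  then show ?thesis
    unfolding sine_transform_def
    by (intro summable_sums summable_finite[of "{..<N}"]) auto
qed

lemma continuous_on_sine_transform [continuous_intros]:
  assumes "finsupp u"
  shows "continuous_on S (sine_transform u)"
proof -
  obtain N where "\<And>k. k \<ge> N \<Longrightarrow> Rep_ell2 u k = 0"
    using assms finsuppE by metis
  then have "sine_transform u = (\<lambda>\<theta>. \<Sum>k<N. sin (real k * \<theta>) *\<^sub>R Rep_ell2 u k)"
    using sine_transform_eq_sum by blast
  then show ?thesis
    by (simp add: continuous_intros)
qed

lemma sine_transform_add:
  assumes "finsupp u" "finsupp v"
  shows "sine_transform (u + v) \<theta> = sine_transform u \<theta> + sine_transform v \<theta>"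
  using sums_add[OF assms[THEN sine_transform_sums]] sine_transform_sums[OF finsupp_add[OF assms]]
  by (intro sums_unique2) (auto simp: plus_ell2.rep_eq scaleR_add_right)

lemma sine_transform_diff:
  assumes "finsupp u" "finsupp v"
  shows "sine_transform (u - v) \<theta> = sine_transform u \<theta> - sine_transform v \<theta>"
  using sums_diff[OF assms[THEN sine_transform_sums]] sine_transform_sums[OF finsupp_diff[OF assms]]
  by (intro sums_unique2) (auto simp: minus_ell2.rep_eq scaleR_diff_right)

lemma sine_transform_scaleR:
  assumes "finsupp u"
  shows "sine_transform (c *\<^sub>R u) \<theta> = c *\<^sub>R sine_transform u \<theta>"
  using sums_scaleR_right[OF sine_transform_sums[OF assms], of c \<theta>]
    sine_transform_sums[OF finsupp_scaleR[OF assms]]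
  by (intro sums_unique2) (auto simp: scaleR_ell2.rep_eq scaleR_conv_of_real mult_ac)

lemma sine_transform_0 [simp]: "sine_transform 0 \<theta> = 0"
  by (simp add: sine_transform_def zero_ell2.rep_eq)

lemma sine_transform_sum:
  assumes "\<And>i. i \<in> I \<Longrightarrow> finsupp (f i)"
  shows "sine_transform (sum f I) \<theta> = (\<Sum>i\<in>I. sine_transform (f i) \<theta>)"
  using assms
  by (induction I rule: infinite_finite_induct) (auto simp: sine_transform_add finsupp_sum)

lemma sine_orthogonality:
  assumes "j \<ge> 1" "k \<ge> 1"
  shows "((\<lambda>\<theta>. sin (real j * \<theta>) * sin (real k * \<theta>)) has_integral (if j = k then pi / 2 else 0)) {0..pi}"
proof -
  have cos: "((\<lambda>\<theta>. cos (real_of_int m * \<theta>)) has_integral (if m = 0 then pi else 0)) {0..pi}" for m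
  proof (cases "m = 0")
    case True
    then show ?thesis using has_integral_const_real[of "1::real" 0 pi] by simp
  next
    case False
    have "((\<lambda>\<theta>. cos (real_of_int m * \<theta>)) has_integral
        (sin (of_int m * pi) / of_int m - sin (of_int m * 0) / of_int m)) {0..pi}"
      using False by (intro fundamental_theorem_of_calculus)
        (auto intro!: derivative_eq_intros simp flip: has_real_derivative_iff_has_vector_derivative)
    then show ?thesis using False by (simp add: sin_int_times_real[symmetric] mult.commute)
  qed
  have "((\<lambda>\<theta>. (cos (of_int (int j - int k) * \<theta>) - cos (of_int (int j + int k) * \<theta>)) / 2) has_integral
     ((if int j - int k = 0 then pi else 0) - (if int j + int k = 0 then pi else 0)) / 2) {0..pi}"
    by (intro has_integral_divide has_integral_diff cos)
  then show ?thesis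
    using assms by (simp add: sin_times_sin left_diff_distrib distrib_right split: if_splits)
qed

text \<open>Parseval's identity, from the orthogonality of the sines. It turns statements about
  \<open>\<ell>\<^sup>2\<close> into statements about integrals over \<open>[0, \<pi>]\<close>.\<close>

lemma parseval:
  assumes "finsupp u" "finsupp v"
  shows "((\<lambda>\<theta>. inner (sine_transform u \<theta>) (sine_transform v \<theta>)) has_integral (pi / 2 * inner u v)) {0..pi}"
proof -
  obtain N where N: "\<And>k. k \<ge> N \<Longrightarrow> Rep_ell2 u k = 0" "\<And>k. k \<ge> N \<Longrightarrow> Rep_ell2 v k = 0"
    using finsuppE[OF assms] by metis
  let ?c = "\<lambda>j k. inner (Rep_ell2 u j) (Rep_ell2 v k)"
  have pair: "((\<lambda>\<theta>. ?c j k * (sin (real j * \<theta>) * sin (real k * \<theta>))) has_integral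
      ?c j k * (if j = k then pi / 2 else 0)) {0..pi}" for j k
  proof (cases "j = 0 \<or> k = 0")
    case True
    then have "?c j k = 0" by auto
    then show ?thesis by simp
  next
    case False
    then show ?thesis by (intro has_integral_mult_right sine_orthogonality) auto
  qed
  have "((\<lambda>\<theta>. \<Sum>j<N. \<Sum>k<N. ?c j k * (sin (real j * \<theta>) * sin (real k * \<theta>))) has_integral
      (\<Sum>j<N. \<Sum>k<N. ?c j k * (if j = k then pi / 2 else 0))) {0..pi}"
    by (intro has_integral_sum pair) auto
  moreover have "(\<Sum>j<N. \<Sum>k<N. ?c j k * (if j = k then pi / 2 else 0)) = pi / 2 * (\<Sum>j<N. ?c j j)"
    by (simp add: if_distrib[of "\<lambda>x. _ * x"] sum.delta sum_distrib_left mult.commute cong: if_cong)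
  moreover have "inner u v = (\<Sum>j<N. ?c j j)"
    by (rule sums_unique2[OF ell2_inner_sums sums_finite]) (use N in auto)
  moreover have "(\<Sum>j<N. \<Sum>k<N. ?c j k * (sin (real j * \<theta>) * sin (real k * \<theta>)))
      = inner (sine_transform u \<theta>) (sine_transform v \<theta>)" for \<theta>
    by (subst sum.swap) (simp add: sine_transform_eq_sum[of N u] sine_transform_eq_sum[of N v] N inner_sum_left inner_sum_right mult_ac sum_distrib_left)
  ultimately show ?thesis by simp
qed

text \<open>The function by which the Laplacian acts after the sine transform.\<close>

definition symbol :: "real \<Rightarrow> real" where
  "symbol \<theta> = 2 - 2 * cos \<theta>"

lemma symbol_bounds: "0 \<le> symbol \<theta>" "symbol \<theta> \<le> 4"
  unfolding symbol_def using cos_le_one[of \<theta>] cos_ge_minus_one[of \<theta>] by linarith+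

lemma finsupp_neg_laplacian:
  assumes "finsupp u"
  shows "finsupp (neg_laplacian u)"
proof -
  obtain N where "\<forall>k\<ge>N. Rep_ell2 u k = 0"
    using assms by (auto simp: finsupp_def)
  then show ?thesis
    unfolding finsupp_def neg_laplacian.rep_eq neg_laplacian_fun.rep_eq
    by (intro exI[of _ "Suc N"]) auto
qed

text \<open>Shift the summation index in the two neighbour terms and use
  \<open>sin ((k - 1) \<theta>) + sin ((k + 1) \<theta>) = 2 cos \<theta> sin (k \<theta>)\<close>. The boundary term at
  index 0 disappears because \<open>sin 0 = 0\<close>.\<close>

lemma sine_transform_neg_laplacian:
  assumes "finsupp u"
  shows "sine_transform (neg_laplacian u) \<theta> = symbol \<theta> *\<^sub>R sine_transform u \<theta>"
proof -
  let ?u = "Rep_ell2 u" and ?s = "\<lambda>k. sin (real k * \<theta>)"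
  have s: "(\<lambda>k. ?s k *\<^sub>R ?u k) sums sine_transform u \<theta>"
    by (rule sine_transform_sums[OF assms])
  obtain N where N: "\<And>k. k \<ge> N \<Longrightarrow> ?u k = 0"
    using assms finsuppE by metis
  let ?p = "\<lambda>k. ?s (k + 1) *\<^sub>R ?u k" and ?m = "\<lambda>k. ?s k *\<^sub>R ?u (k + 1)"
  have p: "?p sums (\<Sum>k. ?p k)"
    by (intro summable_sums summable_finite[of "{..<N}"]) (use N in auto)
  have m: "?m sums (\<Sum>k. ?m k)"
    by (intro summable_sums summable_finite[of "{..<N}"]) (use N in auto)
  have 1: "(\<lambda>k. ?s k *\<^sub>R (if k = 0 then 0 else ?u (k - 1))) sums (\<Sum>k. ?p k)"
    using p sums_Suc_iff[of "\<lambda>k. ?s k *\<^sub>R (if k = 0 then 0 else ?u (k - 1))" "\<Sum>k. ?p k"] by simp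
  have "(\<lambda>k. (if k = 0 then 0 else ?s (k - 1)) *\<^sub>R ?u k) sums (\<Sum>k. ?m k)"
    using m sums_Suc_iff[of "\<lambda>k. (if k = 0 then 0 else ?s (k - 1)) *\<^sub>R ?u k" "\<Sum>k. ?m k"] by simp
  note 2 = sums_add[OF this p]
  have "(if k = 0 then 0 else ?s (k - 1)) *\<^sub>R ?u k + ?p k = (2 * cos \<theta>) *\<^sub>R (?s k *\<^sub>R ?u k)" for k
  proof (cases k)
    case (Suc j)
    have "?s j + ?s (k + 1) = 2 * cos \<theta> * ?s k"
      using sin_plus_sin[of "real j * \<theta>" "real (k + 1) * \<theta>"]
      by (simp add: Suc algebra_simps add_divide_distrib)
    then show ?thesis
      using Suc by (simp flip: scaleR_add_left)
  qed simp
  then have "(\<lambda>k. (2 * cos \<theta>) *\<^sub>R (?s k *\<^sub>R ?u k)) sums ((\<Sum>k. ?m k) + (\<Sum>k. ?p k))"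
    using 2 by presburger
  then have pm: "(\<Sum>k. ?m k) + (\<Sum>k. ?p k) = (2 * cos \<theta>) *\<^sub>R sine_transform u \<theta>"
    using sums_scaleR_right[OF s] sums_unique2 by blast
  have "(\<lambda>k. 2 *\<^sub>R (?s k *\<^sub>R ?u k) - ?s k *\<^sub>R (if k = 0 then 0 else ?u (k - 1)) - ?m k) sums
      (2 *\<^sub>R sine_transform u \<theta> - (\<Sum>k. ?p k) - (\<Sum>k. ?m k))"
    by (intro sums_diff sums_scaleR_right s 1 m)
  moreover have "2 *\<^sub>R (?s k *\<^sub>R ?u k) - ?s k *\<^sub>R (if k = 0 then 0 else ?u (k - 1)) - ?m k =
      ?s k *\<^sub>R Rep_ell2 (neg_laplacian u) k" for k
    by (cases "k = 0") (simp_all add: neg_laplacian.rep_eq neg_laplacian_fun.rep_eq scaleR_conv_of_real algebra_simps)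
  ultimately have "(\<lambda>k. ?s k *\<^sub>R Rep_ell2 (neg_laplacian u) k) sums
      (2 *\<^sub>R sine_transform u \<theta> - (\<Sum>k. ?p k) - (\<Sum>k. ?m k))"
    by simp
  then have "sine_transform (neg_laplacian u) \<theta> = 2 *\<^sub>R sine_transform u \<theta> - ((\<Sum>k. ?m k) + (\<Sum>k. ?p k))"
    using sums_unique2[OF sine_transform_sums[OF finsupp_neg_laplacian[OF assms]]] by (simp add: algebra_simps)
  then show ?thesis
    unfolding pm by (simp add: symbol_def scaleR_diff_left)
qed

section \<open>Polynomials of the Laplacian\<close>

lemma blinfun_poly_apply:
  "blinfun_poly p A u = (\<Sum>i\<le>degree p. coeff p i *\<^sub>R (blinfun_apply A ^^ i) u)"
proof -
  have "blinfun_apply (((\<lambda>B. A o\<^sub>L B) ^^ i) id_blinfun) u = (blinfun_apply A ^^ i) u" for i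
    by (induction i) simp_all
  then show ?thesis
    unfolding blinfun_poly_def by (simp add: blinfun.sum_left blinfun.scaleR_left)
qed

lemma neg_laplacian_power:
  assumes "finsupp u"
  shows "finsupp ((blinfun_apply neg_laplacian ^^ i) u) \<and>
    sine_transform ((blinfun_apply neg_laplacian ^^ i) u) \<theta> = symbol \<theta> ^ i *\<^sub>R sine_transform u \<theta>"
  by (induction i) (use assms in \<open>auto simp: finsupp_neg_laplacian sine_transform_neg_laplacian\<close>)

lemma finsupp_poly:
  assumes "finsupp u"
  shows "finsupp (blinfun_poly p neg_laplacian u)"
  unfolding blinfun_poly_apply using neg_laplacian_power[OF assms]
  by (intro finsupp_sum finsupp_scaleR) blast

lemma sine_transform_poly:
  assumes "finsupp u"
  shows "sine_transform (blinfun_poly p neg_laplacian u) \<theta> = poly p (symbol \<theta>) *\<^sub>R sine_transform u \<theta>"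
  unfolding blinfun_poly_apply poly_altdef using neg_laplacian_power[OF assms]
  by (simp add: sine_transform_sum sine_transform_scaleR finsupp_scaleR scaleR_sum_left)

lemma continuous_on_symbol [continuous_intros]: "continuous_on S symbol"
  unfolding symbol_def by (intro continuous_intros)

text \<open>This bound is what makes the functional calculus work. After the sine transform \<open>p(A) - q(A)\<close> is
  multiplication by \<open>p - q\<close> at the values of the symbol, so Parseval bounds it by the supremum. Values on the
  open interval suffice because the end points are reached by continuity; this matters since the
  functional calculus only sees the spectrum, and only \<open>(0, 4)\<close> is located inside it below.\<close>

lemma norm_poly_diff_le:
  assumes le: "\<And>x. x \<in> {0<..<4} \<Longrightarrow> \<bar>poly p x - poly q x\<bar> \<le> e"
  shows "norm (blinfun_poly p neg_laplacian - blinfun_poly q neg_laplacian) \<le> e"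
proof -
  have le': "\<bar>poly p x - poly q x\<bar> \<le> e" if "x \<in> {0..4}" for x
  proof (rule continuous_le_on_closure[of "{0<..<4}" "\<lambda>x. \<bar>poly p x - poly q x\<bar>"])
    show "continuous_on (closure {0<..<4}) (\<lambda>x. \<bar>poly p x - poly q x\<bar>)"
      by (intro continuous_intros)
  qed (use that le in auto)
  have e: "e \<ge> 0"
    using le[of 1] by simp
  let ?D = "blinfun_poly p neg_laplacian - blinfun_poly q neg_laplacian"
  have fin: "(norm (?D u))\<^sup>2 \<le> e\<^sup>2 * (norm u)\<^sup>2" if u: "finsupp u" for u
  proof -
    have D: "finsupp (?D u)"
      "sine_transform (?D u) \<theta> = (poly p (symbol \<theta>) - poly q (symbol \<theta>)) *\<^sub>R sine_transform u \<theta>" for \<theta>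
      using u by (simp_all add: blinfun.diff_left finsupp_diff finsupp_poly sine_transform_diff
          sine_transform_poly scaleR_diff_left)
    have "pi / 2 * inner (?D u) (?D u) \<le> e\<^sup>2 * (pi / 2 * inner u u)"
    proof (rule has_integral_le[OF parseval[OF D(1) D(1)] has_integral_mult_right[OF parseval[OF u u]]])
      fix \<theta> :: real
      have "(poly p (symbol \<theta>) - poly q (symbol \<theta>))\<^sup>2 \<le> e\<^sup>2"
        using le'[of "symbol \<theta>"] symbol_bounds[of \<theta>] e by (simp add: abs_le_square_iff[symmetric])
      from mult_right_mono[OF this inner_ge_zero[of "sine_transform u \<theta>"]]
      show "inner (sine_transform (?D u) \<theta>) (sine_transform (?D u) \<theta>)
          \<le> e\<^sup>2 * inner (sine_transform u \<theta>) (sine_transform u \<theta>)"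
        by (simp add: D(2) power2_eq_square mult_ac)
    qed
    then show ?thesis
      by (simp add: power2_norm_eq_inner)
  qed
  have "(norm (?D u))\<^sup>2 \<le> e\<^sup>2 * (norm u)\<^sup>2" for u
    by (rule le_by_finsupp[of "\<lambda>u. (norm (?D u))\<^sup>2" "\<lambda>u. e\<^sup>2 * (norm u)\<^sup>2", OF fin])
      (auto intro!: tendsto_intros)
  then have "norm (?D u) \<le> e * norm u" for u
    using e by (simp add: power_mult_distrib[symmetric] abs_le_square_iff[symmetric])
  then show ?thesis
    by (intro norm_blinfun_bound e)
qed

section \<open>The spectrum of the Laplacian\<close>

text \<open>The Lax-Milgram argument: for small \<open>t\<close> the map \<open>u \<mapsto> u - t (C u - v)\<close> is a contraction, and its
  fixed point solves \<open>C u = v\<close>. Coercivity then bounds the inverse by \<open>1 / d\<close>.\<close>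

lemma coercive_imp_invertible:
  fixes C :: "'a :: {real_inner, complete_space} \<Rightarrow>\<^sub>L 'a"
  assumes d: "d > 0" and coer: "\<And>u. d * (norm u)\<^sup>2 \<le> inner u (C u)"
  obtains R :: "'a \<Rightarrow>\<^sub>L 'a" where "\<And>v. C (R v) = v" "\<And>u. R (C u) = u"
proof -
  \<comment> \<open>Any bound for the norm of C that is also at least d works for K; the value of t minimises
    \<open>1 - 2 t d + t\<^sup>2 K\<^sup>2\<close>, and the minimum is \<open>c\<^sup>2\<close>.\<close>
  define K where "K = norm C + d"
  define t where "t = d / K\<^sup>2"
  define c where "c = sqrt (1 - (d / K)\<^sup>2)"
  have K: "K > 0" "norm C \<le> K" "d \<le> K"
    using d norm_ge_zero[of C] by (auto simp: K_def add_nonneg_pos)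
  then have t: "t > 0"
    using d by (simp add: t_def)
  have dK: "0 < (d / K)\<^sup>2" "(d / K)\<^sup>2 \<le> 1"
    using K d by (auto simp: power_le_one)
  then have c: "0 \<le> c" "c < 1" "c\<^sup>2 = 1 - (d / K)\<^sup>2"
    by (auto simp: c_def)
  have contr: "norm (u - t *\<^sub>R C u) \<le> c * norm u" for u
  proof -
    have "norm (C u) \<le> K * norm u"
      using norm_blinfun[of C u] K(2) by (meson mult_right_mono norm_ge_zero order_trans)
    then have "(norm (C u))\<^sup>2 \<le> K\<^sup>2 * (norm u)\<^sup>2"
      by (simp add: power_mono flip: power_mult_distrib)
    then have 1: "t\<^sup>2 * (norm (C u))\<^sup>2 \<le> t\<^sup>2 * (K\<^sup>2 * (norm u)\<^sup>2)"
      by (intro mult_left_mono) auto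
    have 2: "2 * t * (d * (norm u)\<^sup>2) \<le> 2 * t * inner u (C u)"
      using coer[of u] t by (intro mult_left_mono) auto
    have "(norm (u - t *\<^sub>R C u))\<^sup>2 = (norm u)\<^sup>2 - 2 * t * inner u (C u) + t\<^sup>2 * (norm (C u))\<^sup>2"
      by (simp add: power2_norm_eq_inner inner_diff_left inner_diff_right inner_commute power2_eq_square[of t])
    also have "\<dots> \<le> (norm u)\<^sup>2 - 2 * t * (d * (norm u)\<^sup>2) + t\<^sup>2 * (K\<^sup>2 * (norm u)\<^sup>2)"
      using 1 2 by linarith
    also have "\<dots> = (c * norm u)\<^sup>2"
      unfolding power_mult_distrib c(3) using K by (simp add: t_def field_simps power2_eq_square)
    finally show ?thesis
      by (rule power2_le_imp_le) (simp add: c)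
  qed
  have ex: "\<exists>!u. C u = v" for v
  proof -
    have "\<exists>!u. u - t *\<^sub>R (C u - v) = u"
    proof (rule banach_fix_type[OF c(1,2)], intro allI)
      fix x y
      show "dist (x - t *\<^sub>R (C x - v)) (y - t *\<^sub>R (C y - v)) \<le> c * dist x y"
        using contr[of "x - y"] by (simp add: dist_norm blinfun.diff_right algebra_simps)
    qed
    then show ?thesis
      using t by simp
  qed
  define r where "r v = (THE u. C u = v)" for v
  have Cr: "C (r v) = v" for v
    unfolding r_def by (rule theI'[OF ex])
  have rC: "r (C u) = u" for u
    using ex Cr by metis
  have "bounded_linear r"
  proof (rule bounded_linear_intro[where K = "1 / d"])
    show "r (v + w) = r v + r w" for v w
      using rC[of "r v + r w"] by (simp add: blinfun.add_right Cr)
    show "r (a *\<^sub>R v) = a *\<^sub>R r v" for a v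
      using rC[of "a *\<^sub>R r v"] by (simp add: blinfun.scaleR_right Cr)
    show "norm (r v) \<le> norm v * (1 / d)" for v
    proof (cases "r v = 0")
      case False
      have "d * (norm (r v))\<^sup>2 \<le> inner (r v) v"
        using coer[of "r v"] by (simp add: Cr)
      also have "\<dots> \<le> norm (r v) * norm v"
        by (rule norm_cauchy_schwarz)
      finally have "(d * norm (r v)) * norm (r v) \<le> norm v * norm (r v)"
        by (simp add: power2_eq_square mult_ac)
      then have "d * norm (r v) \<le> norm v"
        using False by (simp add: mult_le_cancel_right)
      then show ?thesis
        using d by (simp add: field_simps)
    qed (use d in simp)
  qed
  then show ?thesis
    using that[of "Blinfun r"] Cr rC by (simp add: bounded_linear_Blinfun_apply)
qed

lemma not_in_real_spectrumI:
  fixes R :: "ell2 \<Rightarrow>\<^sub>L ell2"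
  assumes "\<And>v. R v \<in> D" "\<And>v. T (R v) - x *\<^sub>R R v = v" "\<And>u. u \<in> D \<Longrightarrow> R (T u - x *\<^sub>R u) = u"
  shows "x \<notin> real_spectrum_on D T"
  unfolding real_spectrum_on_def spectrum_on_def using assms by (auto simp: scaleR_ell2_cscale)

lemma nonneg_imp_neg_not_in_real_spectrum:
  fixes B :: "ell2 \<Rightarrow>\<^sub>L ell2"
  assumes "\<And>u. 0 \<le> inner u (B u)" "x < 0"
  shows "x \<notin> real_spectrum_on UNIV B"
proof -
  have "- x * (norm u)\<^sup>2 \<le> inner u ((B - x *\<^sub>R id_blinfun) u)" for u
    using assms(1)[of u]
    by (simp add: blinfun.diff_left blinfun.scaleR_left inner_diff_right power2_norm_eq_inner)
  then obtain R :: "ell2 \<Rightarrow>\<^sub>L ell2" where "\<And>v. (B - x *\<^sub>R id_blinfun) (R v) = v" "\<And>u. R ((B - x *\<^sub>R id_blinfun) u) = u"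
    using coercive_imp_invertible[of "- x" "B - x *\<^sub>R id_blinfun"] assms(2) by auto
  then show ?thesis
    by (intro not_in_real_spectrumI[of R]) (simp_all add: blinfun.diff_left blinfun.scaleR_left)
qed

text \<open>The symbol takes values in \<open>[0, 4]\<close>, so both \<open>A\<close> and \<open>4 - A\<close> are nonnegative, and outside
  \<open>[0, 4]\<close> one of \<open>A - x\<close> and \<open>x - A\<close> is coercive.\<close>

lemma real_spectrum_neg_laplacian_subset: "real_spectrum_on UNIV neg_laplacian \<subseteq> {0..4}"
proof -
  have fin: "pi / 2 * inner u (neg_laplacian u) \<ge> 0"
    "pi / 2 * inner u (neg_laplacian u) \<le> 4 * (pi / 2 * inner u u)" if u: "finsupp u" for u
  proof -
    note Au = finsupp_neg_laplacian[OF u]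
    have nn: "symbol \<theta> * inner (sine_transform u \<theta>) (sine_transform u \<theta>) \<ge> 0" for \<theta>
      using symbol_bounds(1) by (intro mult_nonneg_nonneg) auto
    show "pi / 2 * inner u (neg_laplacian u) \<ge> 0"
      by (rule has_integral_nonneg[OF parseval[OF u Au]])
         (use nn in \<open>simp add: sine_transform_neg_laplacian[OF u]\<close>)
    show "pi / 2 * inner u (neg_laplacian u) \<le> 4 * (pi / 2 * inner u u)"
      by (rule has_integral_le[OF parseval[OF u Au] has_integral_mult_right[OF parseval[OF u u]]])
         (use mult_right_mono[OF symbol_bounds(2) inner_ge_zero]
           in \<open>simp add: sine_transform_neg_laplacian[OF u]\<close>)
  qed
  have fin': "0 \<le> inner u (neg_laplacian u)" if "finsupp u" for u
    using fin(1)[OF that] pi_gt_zero by (simp add: zero_le_mult_iff)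
  have ge: "0 \<le> inner u (neg_laplacian u)" for u
    by (rule le_by_finsupp[of "\<lambda>_. 0" "\<lambda>u. inner u (neg_laplacian u)"]) (auto intro!: tendsto_intros fin')
  have le: "inner u (neg_laplacian u) \<le> 4 * inner u u" for u
    by (rule le_by_finsupp[of "\<lambda>u. inner u (neg_laplacian u)" "\<lambda>u. 4 * inner u u"])
      (use fin in \<open>auto intro!: tendsto_intros simp: mult.left_commute[of 4]\<close>)
  have "x \<notin> real_spectrum_on UNIV neg_laplacian" if x: "x > 4" for x
  proof -
    have "(x - 4) * (norm u)\<^sup>2 \<le> inner u ((x *\<^sub>R id_blinfun - neg_laplacian) u)" for u
      using le[of u]
      by (simp add: blinfun.diff_left blinfun.scaleR_left inner_diff_right power2_norm_eq_inner algebra_simps)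
    then obtain R :: "ell2 \<Rightarrow>\<^sub>L ell2" where R: "\<And>v. (x *\<^sub>R id_blinfun - neg_laplacian) (R v) = v"
        "\<And>u. R ((x *\<^sub>R id_blinfun - neg_laplacian) u) = u"
      using coercive_imp_invertible[of "x - 4" "x *\<^sub>R id_blinfun - neg_laplacian"] x by auto
    show ?thesis
    proof (rule not_in_real_spectrumI[of "- R"])
      show "neg_laplacian ((- R) v) - x *\<^sub>R (- R) v = v" for v
        using R(1)[of v] by (simp add: blinfun.diff_left blinfun.scaleR_left blinfun.minus_left blinfun.minus_right)
      show "(- R) (neg_laplacian u - x *\<^sub>R u) = u" for u
        using R(2)[of u] by (simp add: blinfun.diff_left blinfun.scaleR_left blinfun.minus_left blinfun.diff_right)
    qed simp
  qed
  moreover have "x \<notin> real_spectrum_on UNIV neg_laplacian" if "x < 0" for x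
    using nonneg_imp_neg_not_in_real_spectrum[OF ge that] .
  ultimately show ?thesis
    by (metis atLeastAtMost_iff not_le subsetI)
qed

text \<open>For \<open>0 < x < 4\<close> the equation \<open>(A - x) u = \<delta>\<^sub>1\<close> has no square summable solution: the recurrence
  conserves the quadratic form \<open>a\<^sup>2 + b\<^sup>2 - (2 - x) a b\<close> of consecutive entries, which is positive
  definite. Square summability makes its value 0, so the first two entries vanish, and this contradicts
  the equation at index 1.\<close>

lemma real_spectrum_neg_laplacian_superset: "{0<..<4} \<subseteq> real_spectrum_on UNIV neg_laplacian"
proof
  fix x :: real
  assume x: "x \<in> {0<..<4}"
  show "x \<in> real_spectrum_on UNIV neg_laplacian"
  proof (rule ccontr)
    assume "x \<notin> real_spectrum_on UNIV neg_laplacian"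
    then obtain R :: "ell2 \<Rightarrow>\<^sub>L ell2" where R: "\<And>v. neg_laplacian (R v) - x *\<^sub>R R v = v"
      unfolding real_spectrum_on_def spectrum_on_def by (auto simp: scaleR_ell2_cscale)
    have "summable (\<lambda>k :: nat. (cmod (if k = 1 then 1 else 0))\<^sup>2)"
      by (rule summable_finite[of "{1}"]) auto
    then obtain e :: ell2 where e: "Rep_ell2 e = (\<lambda>k. if k = 1 then 1 else 0)"
      using Abs_ell2_inverse[of "\<lambda>k. if k = 1 then 1 else 0"] by auto
    define a where "a k = Re (Rep_ell2 (R e) k)" for k
    have eq: "Rep_ell2 (neg_laplacian (R e) - x *\<^sub>R R e) k = Rep_ell2 e k" for k
      by (simp add: R)
    have "- a k + 2 * a (Suc k) - a (Suc (Suc k)) - x * a (Suc k) = (if k = 0 then 1 else 0)" for k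
      using arg_cong[OF eq[of "Suc k"], of Re]
      by (simp add: a_def minus_ell2.rep_eq scaleR_ell2.rep_eq neg_laplacian.rep_eq neg_laplacian_fun.rep_eq e)
    then have rec: "a (Suc (Suc k)) = (2 - x) * a (Suc k) - a k - (if k = 0 then 1 else 0)" for k
      by (simp add: algebra_simps split: if_splits)
    let ?E = "\<lambda>k. (a (Suc k))\<^sup>2 + (a (Suc (Suc k)))\<^sup>2 - (2 - x) * a (Suc k) * a (Suc (Suc k))"
    have step: "?E (Suc k) = ?E k" for k
      unfolding rec[of "Suc k"] by (simp add: power2_eq_square algebra_simps)
    have const: "?E k = ?E 0" for k
      by (induction k) (simp_all only: step)
    have "(\<lambda>k. (cmod (Rep_ell2 (R e) k))\<^sup>2) \<longlonglongrightarrow> 0"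
      by (rule summable_LIMSEQ_zero[OF ell2_summable])
    from tendsto_real_sqrt[OF this] have "a \<longlonglongrightarrow> 0"
      by (intro Lim_null_comparison[of a]) (auto simp: a_def abs_Re_le_cmod)
    then have a1: "(\<lambda>k. a (Suc k)) \<longlonglongrightarrow> 0"
      by (rule LIMSEQ_Suc)
    then have "(\<lambda>k. a (Suc (Suc k))) \<longlonglongrightarrow> 0"
      by (rule LIMSEQ_Suc)
    with a1 have "?E \<longlonglongrightarrow> 0\<^sup>2 + 0\<^sup>2 - (2 - x) * 0 * 0"
      by (intro tendsto_intros)
    moreover have "?E = (\<lambda>_. ?E 0)"
      by (rule ext) (rule const)
    ultimately have "(\<lambda>_. ?E 0) \<longlonglongrightarrow> 0\<^sup>2 + 0\<^sup>2 - (2 - x) * 0 * 0"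
      by (simp only:)
    then have "?E 0 = 0"
      unfolding LIMSEQ_const_iff by simp
    \<comment> \<open>The form is positive definite exactly because both coefficients are positive for \<open>0 < x < 4\<close>.\<close>
    moreover have "?E 0 = x / 4 * (a 1 + a 2)\<^sup>2 + (4 - x) / 4 * (a 1 - a 2)\<^sup>2"
      by (simp add: numeral_2_eq_2 power2_eq_square) (simp add: field_simps)
    moreover have "x / 4 * (a 1 + a 2)\<^sup>2 \<ge> 0" "(4 - x) / 4 * (a 1 - a 2)\<^sup>2 \<ge> 0"
      using x by auto
    ultimately have "x / 4 * (a 1 + a 2)\<^sup>2 = 0 \<and> (4 - x) / 4 * (a 1 - a 2)\<^sup>2 = 0"
      by linarith
    then have "a 1 = 0 \<and> a 2 = 0"
      using x by auto
    then show False
      using rec[of 0] by (simp add: a_def numeral_2_eq_2)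
  qed
qed

section \<open>Continuous functions of the Laplacian\<close>

lemma Weierstrass_poly_sequence:
  fixes f :: "real \<Rightarrow> real"
  assumes "compact S" "continuous_on S f"
  obtains p where "uniform_limit S (\<lambda>n x. poly (p n) x) f sequentially"
proof -
  have "\<exists>p. \<forall>x\<in>S. \<bar>f x - poly p x\<bar> < 1 / real (Suc n)" for n
  proof -
    obtain g where g: "real_polynomial_function g" "\<And>x. x \<in> S \<Longrightarrow> \<bar>f x - g x\<bar> < 1 / real (Suc n)"
      using Stone_Weierstrass_real_polynomial_function[OF assms, of "1 / real (Suc n)"] by auto
    then obtain a N where "g = (\<lambda>x. \<Sum>i\<le>N. a i * x ^ i)"
      unfolding real_polynomial_function_iff_sum by blast
    then have "g x = poly (\<Sum>i\<le>N. monom (a i) i) x" for x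
      by (simp add: poly_sum poly_monom)
    then show ?thesis
      using g(2) by metis
  qed
  then obtain p where p: "\<And>n x. x \<in> S \<Longrightarrow> \<bar>f x - poly (p n) x\<bar> < 1 / real (Suc n)"
    by metis
  have "uniform_limit S (\<lambda>n x. poly (p n) x) f sequentially"
  proof (rule uniform_limitI)
    fix e :: real assume "e > 0"
    then have "\<forall>\<^sub>F n in sequentially. 1 / real (Suc n) < e"
      using LIMSEQ_inverse_real_of_nat by (intro order_tendstoD) (auto simp: field_simps inverse_eq_divide)
    then show "\<forall>\<^sub>F n in sequentially. \<forall>x\<in>S. dist (poly (p n) x) (f x) < e"
    proof (rule eventually_mono)
      fix n assume "1 / real (Suc n) < e"
      then show "\<forall>x\<in>S. dist (poly (p n) x) (f x) < e"
        using p[of _ n] by (force simp: dist_real_def abs_minus_commute)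
    qed
  qed
  then show ?thesis by (rule that)
qed

lemma uniform_limit_imp_poly_diff_small:
  fixes f :: "real \<Rightarrow> real"
  assumes "uniform_limit S (\<lambda>n x. poly (p n) x) f sequentially"
    and "uniform_limit S (\<lambda>n x. poly (q n) x) f sequentially"
    and "{0<..<4} \<subseteq> S" "e > 0"
  shows "\<exists>N. \<forall>m\<ge>N. \<forall>n\<ge>N. norm (blinfun_poly (p m) neg_laplacian - blinfun_poly (q n) neg_laplacian) \<le> e"
proof -
  have "\<forall>\<^sub>F n in sequentially. \<forall>x\<in>S. dist (poly (p n) x) (f x) < e / 2"
    "\<forall>\<^sub>F n in sequentially. \<forall>x\<in>S. dist (poly (q n) x) (f x) < e / 2"
    using assms(1,2,4) by (auto dest: uniform_limitD[of _ _ _ _ "e / 2"])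
  then have "\<forall>\<^sub>F n in sequentially. (\<forall>x\<in>S. dist (poly (p n) x) (f x) < e / 2) \<and> (\<forall>x\<in>S. dist (poly (q n) x) (f x) < e / 2)"
    by (rule eventually_conj)
  then obtain N where N: "\<And>n x. n \<ge> N \<Longrightarrow> x \<in> S \<Longrightarrow> dist (poly (p n) x) (f x) < e / 2 \<and> dist (poly (q n) x) (f x) < e / 2"
    unfolding eventually_sequentially by blast
  have "norm (blinfun_poly (p m) neg_laplacian - blinfun_poly (q n) neg_laplacian) \<le> e" if "m \<ge> N" "n \<ge> N" for m n
  proof (rule norm_poly_diff_le)
    fix x :: real assume "x \<in> {0<..<4}"
    then show "\<bar>poly (p m) x - poly (q n) x\<bar> \<le> e"
      using N[OF that(1), of x] N[OF that(2), of x] subsetD[OF assms(3), of x] unfolding dist_real_def abs_real_def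
      by (auto split: if_splits)
  qed
  then show ?thesis by blast
qed

text \<open>The definite description defining \<open>f(A)\<close> denotes: one sequence of polynomials converging uniformly on
  \<open>[0, 4]\<close> yields a norm convergent sequence of operators, and every other admissible sequence has the
  same limit because the spectrum contains \<open>(0, 4)\<close>.\<close>

lemma fun_calc_LIMSEQ:
  assumes f: "continuous_on {0..4} f"
    and p: "uniform_limit (real_spectrum_on UNIV neg_laplacian) (\<lambda>n x. poly (p n) x) f sequentially"
  shows "(\<lambda>n. blinfun_poly (p n) neg_laplacian) \<longlonglongrightarrow> fun_calc f neg_laplacian"
proof -
  let ?S = "real_spectrum_on UNIV neg_laplacian"
  obtain q where q: "uniform_limit {0..4} (\<lambda>n x. poly (q n) x) f sequentially"
    using Weierstrass_poly_sequence[OF compact_Icc f] .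
  then have q: "uniform_limit ?S (\<lambda>n x. poly (q n) x) f sequentially"
    using real_spectrum_neg_laplacian_subset by (rule uniform_limit_on_subset)
  have "Cauchy (\<lambda>n. blinfun_poly (q n) neg_laplacian)"
    unfolding Cauchy_altdef2
  proof (intro allI impI)
    fix e :: real assume "e > 0"
    then obtain N where "\<forall>m\<ge>N. \<forall>n\<ge>N. norm (blinfun_poly (q m) neg_laplacian - blinfun_poly (q n) neg_laplacian) \<le> e / 2"
      using uniform_limit_imp_poly_diff_small[OF q q real_spectrum_neg_laplacian_superset, of "e / 2"] by auto
    then show "\<exists>N. \<forall>n\<ge>N. dist (blinfun_poly (q n) neg_laplacian) (blinfun_poly (q N) neg_laplacian) < e"
      using \<open>e > 0\<close> by (intro exI[of _ N]) (force simp: dist_norm)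
  qed
  then obtain B where B: "(\<lambda>n. blinfun_poly (q n) neg_laplacian) \<longlonglongrightarrow> B"
    using Cauchy_convergent convergent_def by blast
  have all: "(\<lambda>n. blinfun_poly (p n) neg_laplacian) \<longlonglongrightarrow> B"
    if p: "uniform_limit ?S (\<lambda>n x. poly (p n) x) f sequentially" for p
  proof -
    have "(\<lambda>n. blinfun_poly (p n) neg_laplacian - blinfun_poly (q n) neg_laplacian) \<longlonglongrightarrow> 0"
    proof (rule LIMSEQ_I)
      fix e :: real assume "e > 0"
      then obtain N where "\<forall>m\<ge>N. \<forall>n\<ge>N. norm (blinfun_poly (p m) neg_laplacian - blinfun_poly (q n) neg_laplacian) \<le> e / 2"
        using uniform_limit_imp_poly_diff_small[OF p q real_spectrum_neg_laplacian_superset, of "e / 2"] by auto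
      then show "\<exists>N. \<forall>n\<ge>N. norm (blinfun_poly (p n) neg_laplacian - blinfun_poly (q n) neg_laplacian - 0) < e"
        using \<open>e > 0\<close> by (intro exI[of _ N]) force
    qed
    from tendsto_add[OF this B] show ?thesis by simp
  qed
  have "fun_calc f neg_laplacian = B"
    unfolding fun_calc_def
  proof (rule the_equality)
    fix B' assume "\<forall>p. uniform_limit ?S (\<lambda>n x. poly (p n) x) f sequentially \<longrightarrow>
      (\<lambda>n. blinfun_poly (p n) neg_laplacian) \<longlonglongrightarrow> B'"
    then show "B' = B"
      using q B LIMSEQ_unique by blast
  qed (use all in blast)
  then show ?thesis
    using all[OF p] by simp
qed

lemma fun_calc_approx:
  assumes "continuous_on {0..4} f"
  obtains p where "uniform_limit {0..4} (\<lambda>n x. poly (p n) x) f sequentially"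
    "\<And>u. (\<lambda>n. blinfun_poly (p n) neg_laplacian u) \<longlonglongrightarrow> fun_calc f neg_laplacian u"
proof -
  obtain p where p: "uniform_limit {0..4} (\<lambda>n x. poly (p n) x) f sequentially"
    using Weierstrass_poly_sequence[OF compact_Icc assms] .
  then have "(\<lambda>n. blinfun_poly (p n) neg_laplacian) \<longlonglongrightarrow> fun_calc f neg_laplacian"
    using fun_calc_LIMSEQ[OF assms] uniform_limit_on_subset real_spectrum_neg_laplacian_subset by blast
  from blinfun.tendsto[OF this tendsto_const] p show ?thesis
    using that by blast
qed

lemma uniform_limit_integral_weight:
  fixes f h :: "real \<Rightarrow> real"
  assumes p: "uniform_limit {0..4} (\<lambda>n x. poly (p n) x) f sequentially"
    and f: "continuous_on {0..4} f" and h: "continuous_on {0..pi} h"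
  shows "(\<lambda>n. integral {0..pi} (\<lambda>\<theta>. poly (p n) (symbol \<theta>) * h \<theta>))
    \<longlonglongrightarrow> integral {0..pi} (\<lambda>\<theta>. f (symbol \<theta>) * h \<theta>)"
proof -
  have cf: "continuous_on {0..pi} (\<lambda>\<theta>. f (symbol \<theta>))"
    using symbol_bounds by (intro continuous_on_compose2[OF f] continuous_intros) auto
  have "uniform_limit {0..pi} (\<lambda>n \<theta>. poly (p n) (symbol \<theta>)) (\<lambda>\<theta>. f (symbol \<theta>)) sequentially"
    using uniform_limit_compose'[OF p, of symbol "{0..pi}"] symbol_bounds by auto
  then have ul: "uniform_limit {0..pi} (\<lambda>n \<theta>. poly (p n) (symbol \<theta>) * h \<theta>) (\<lambda>\<theta>. f (symbol \<theta>) * h \<theta>) sequentially"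
    by (intro uniform_lim_mult uniform_limit_const compact_imp_bounded compact_continuous_image cf h compact_Icc)
  have "continuous_on {0..pi} (\<lambda>\<theta>. poly (p n) (symbol \<theta>) * h \<theta>)" for n
    by (intro continuous_intros h)
  then obtain I J where IJ: "\<And>n. ((\<lambda>\<theta>. poly (p n) (symbol \<theta>) * h \<theta>) has_integral I n) {0..pi}"
    "((\<lambda>\<theta>. f (symbol \<theta>) * h \<theta>) has_integral J) {0..pi}" "I \<longlonglongrightarrow> J"
    using uniform_limit_integral[OF ul] by auto
  then show ?thesis
    using integral_unique by (simp add: integral_unique[OF IJ(1)] integral_unique[OF IJ(2)])
qed

text \<open>The spectral representation of \<open>f(A)\<close>: true for polynomials by Parseval, and preserved under uniform
  limits on both sides.\<close>

lemma fun_calc_form: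
  assumes f: "continuous_on {0..4} f" and u: "finsupp u"
  shows "pi / 2 * inner u (fun_calc f neg_laplacian u)
    = integral {0..pi} (\<lambda>\<theta>. f (symbol \<theta>) * (cmod (sine_transform u \<theta>))\<^sup>2)"
proof -
  obtain p where p: "uniform_limit {0..4} (\<lambda>n x. poly (p n) x) f sequentially"
    "\<And>u. (\<lambda>n. blinfun_poly (p n) neg_laplacian u) \<longlonglongrightarrow> fun_calc f neg_laplacian u"
    using fun_calc_approx[OF f] by blast
  have "(\<lambda>n. pi / 2 * inner u (blinfun_poly (p n) neg_laplacian u)) \<longlonglongrightarrow> pi / 2 * inner u (fun_calc f neg_laplacian u)"
    by (intro tendsto_intros p)
  moreover have "pi / 2 * inner u (blinfun_poly (p n) neg_laplacian u)
      = integral {0..pi} (\<lambda>\<theta>. poly (p n) (symbol \<theta>) * (cmod (sine_transform u \<theta>))\<^sup>2)" for n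
    using integral_unique[OF parseval[OF u finsupp_poly[OF u, of "p n"]]]
    by (simp add: sine_transform_poly[OF u] power2_norm_eq_inner)
  moreover have "(\<lambda>n. integral {0..pi} (\<lambda>\<theta>. poly (p n) (symbol \<theta>) * (cmod (sine_transform u \<theta>))\<^sup>2))
      \<longlonglongrightarrow> integral {0..pi} (\<lambda>\<theta>. f (symbol \<theta>) * (cmod (sine_transform u \<theta>))\<^sup>2)"
    by (intro uniform_limit_integral_weight p f continuous_intros u)
  ultimately show ?thesis
    using LIMSEQ_unique by (simp only:)
qed

lemma selfadjoint_neg_laplacian: "selfadjoint neg_laplacian"
proof -
  have SL: "cinner (shift_right u) v = cinner u (shift_left v)" for u v
  proof (rule sums_unique2[OF cinner_sums])
    have "(\<lambda>n. cnj (Rep_ell2 u n) * Rep_ell2 (shift_left v) n) =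
        (\<lambda>n. cnj (Rep_ell2 (shift_right u) (Suc n)) * Rep_ell2 v (Suc n))"
      by (auto simp: shift_left.rep_eq shift_right.rep_eq)
    then show "(\<lambda>n. cnj (Rep_ell2 (shift_right u) n) * Rep_ell2 v n) sums cinner u (shift_left v)"
      using cinner_sums[of u "shift_left v"]
        sums_Suc_iff[of "\<lambda>n. cnj (Rep_ell2 (shift_right u) n) * Rep_ell2 v n"] by simp
  qed
  have LS: "cinner (shift_left u) v = cinner u (shift_right v)" for u v
    using SL[of v u] cinner_commute[of "shift_left u" v] cinner_commute[of u "shift_right v"] by simp
  have diff_right: "cinner u (v - w) = cinner u v - cinner u w" for u v w
    using sums_diff[OF cinner_sums[of u v] cinner_sums[of u w]]
    by (intro sums_unique2[OF cinner_sums]) (simp add: minus_ell2.rep_eq algebra_simps)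
  have diff_left: "cinner (v - w) u = cinner v u - cinner w u" for u v w
    using diff_right[of u v w] cinner_commute[of "v - w" u] cinner_commute[of v u] cinner_commute[of w u]
    by simp
  have scale: "cinner (r *\<^sub>R u) v = cinner u (r *\<^sub>R v)" for r u v
  proof -
    have "cinner (cscale (complex_of_real r) u) v = cnj (cinner v (cscale (complex_of_real r) u))"
      by (rule cinner_commute)
    also have "\<dots> = complex_of_real r * cinner u v"
      using cinner_commute[of u v] by (simp add: cinner_cscale_right)
    finally show ?thesis
      by (simp add: scaleR_ell2_cscale cinner_cscale_right)
  qed
  show ?thesis
    unfolding selfadjoint_def neg_laplacian.rep_eq neg_laplacian_fun_shift
    by (simp add: diff_left diff_right scale SL LS)
qed

lemma selfadjoint_blinfun_poly:
  assumes A: "selfadjoint A"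
  shows "selfadjoint (blinfun_poly p A)"
proof -
  have add_right: "cinner u (v + w) = cinner u v + cinner u w" for u v w
    using sums_add[OF cinner_sums[of u v] cinner_sums[of u w]]
    by (intro sums_unique2[OF cinner_sums]) (simp add: plus_ell2.rep_eq algebra_simps)
  have scale: "cinner (r *\<^sub>R u) v = complex_of_real r * cinner u v"
    "cinner u (r *\<^sub>R v) = complex_of_real r * cinner u v" for r u v
    using cinner_commute[of "r *\<^sub>R u" v] cinner_commute[of u v]
    by (simp_all add: scaleR_ell2_cscale cinner_cscale_right)
  have zero: "cinner 0 u = 0" "cinner u 0 = 0" for u
    using scale(1)[of 0] scale(2)[of _ 0] by simp_all
  have pow: "cinner ((blinfun_apply A ^^ i) u) v = cinner u ((blinfun_apply A ^^ i) v)" for i u v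
  proof (induction i arbitrary: v)
    case (Suc i)
    have "cinner (A ((blinfun_apply A ^^ i) u)) v = cinner u ((blinfun_apply A ^^ i) (A v))"
      using A Suc unfolding selfadjoint_def by simp
    then show ?case
      by (simp add: funpow_swap1)
  qed simp
  have "cinner (\<Sum>i\<in>I. coeff p i *\<^sub>R (blinfun_apply A ^^ i) u) v = cinner u (\<Sum>i\<in>I. coeff p i *\<^sub>R (blinfun_apply A ^^ i) v)"
    for I u v
    by (induction I rule: infinite_finite_induct) (simp_all add: cinner_add_left add_right scale zero pow)
  then show ?thesis
    unfolding selfadjoint_def blinfun_poly_apply by blast
qed

text \<open>Continuity is inherited from the real inner product: the imaginary part of the complex one is again a
  real inner product after moving the factor \<open>\<i>\<close> to the fixed argument.\<close>

lemma tendsto_cinner_right: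
  assumes "X \<longlonglongrightarrow> v"
  shows "(\<lambda>n. cinner u (X n)) \<longlonglongrightarrow> cinner u v"
proof -
  have *: "inner u (cscale (- \<i>) w) = - inner (cscale (- \<i>) u) w" for w
  proof -
    have "inner u (cscale (- \<i>) w) = Im (cinner u w)"
      by (simp add: inner_ell2_def cinner_cscale_right)
    also have "\<dots> = - Im (cinner w u)"
      by (subst cinner_commute) simp
    also have "\<dots> = - inner w (cscale (- \<i>) u)"
      by (simp add: inner_ell2_def cinner_cscale_right)
    finally show ?thesis by (simp add: inner_commute)
  qed
  show ?thesis
    unfolding cinner_eq_inner * by (intro tendsto_intros assms)
qed

lemma selfadjoint_fun_calc:
  assumes "continuous_on {0..4} f"
  shows "selfadjoint (fun_calc f neg_laplacian)"
proof -
  obtain p where p: "\<And>u. (\<lambda>n. blinfun_poly (p n) neg_laplacian u) \<longlonglongrightarrow> fun_calc f neg_laplacian u"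
    using fun_calc_approx[OF assms] by blast
  have "cinner (fun_calc f neg_laplacian u) v = cinner u (fun_calc f neg_laplacian v)" for u v
  proof (rule LIMSEQ_unique)
    show "(\<lambda>n. cinner u (blinfun_poly (p n) neg_laplacian v)) \<longlonglongrightarrow> cinner u (fun_calc f neg_laplacian v)"
      by (intro tendsto_cinner_right p)
    have "(\<lambda>n. cnj (cinner v (blinfun_poly (p n) neg_laplacian u))) \<longlonglongrightarrow> cnj (cinner v (fun_calc f neg_laplacian u))"
      by (intro tendsto_cnj tendsto_cinner_right p)
    then show "(\<lambda>n. cinner u (blinfun_poly (p n) neg_laplacian v)) \<longlonglongrightarrow> cinner (fun_calc f neg_laplacian u) v"
      using selfadjoint_blinfun_poly[OF selfadjoint_neg_laplacian] unfolding selfadjoint_def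
      by (simp add: cinner_commute[symmetric])
  qed
  then show ?thesis
    by (simp add: selfadjoint_def)
qed

lemma continuous_on_powr_nonneg: "\<alpha> > 0 \<Longrightarrow> continuous_on {0..4} (\<lambda>x :: real. x powr \<alpha>)"
  by (intro continuous_on_powr' continuous_intros) auto

section \<open>Negative spectrum and negative energy\<close>

text \<open>Vectors on which a nonnegative form is small are almost in the kernel of its operator. The proof
  evaluates the form at \<open>v - s B v\<close> with \<open>s\<close> the reciprocal of the norm of \<open>B\<close>.\<close>

lemma semidefinite_cauchy_schwarz:
  fixes B :: "'a :: real_inner \<Rightarrow>\<^sub>L 'a"
  assumes sym: "\<And>v w. inner (B v) w = inner v (B w)" and nonneg: "\<And>v. 0 \<le> inner v (B v)"
  shows "(norm (B v))\<^sup>2 \<le> norm B * inner v (B v)"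
proof (cases "norm B = 0")
  case False
  define s where "s = 1 / norm B"
  have s: "s > 0" "s * norm B = 1"
    using False by (auto simp: s_def)
  have "inner (B v) (B (B v)) \<le> norm (B v) * norm (B (B v))"
    by (rule norm_cauchy_schwarz)
  also have "\<dots> \<le> norm (B v) * (norm B * norm (B v))"
    by (intro mult_left_mono norm_blinfun) auto
  finally have "s\<^sup>2 * inner (B v) (B (B v)) \<le> s\<^sup>2 * (norm (B v) * (norm B * norm (B v)))"
    by (intro mult_left_mono) auto
  also have "\<dots> = (s * norm B) * (s * (norm (B v))\<^sup>2)"
    by (simp add: power2_eq_square)
  finally have 1: "s\<^sup>2 * inner (B v) (B (B v)) \<le> s * (norm (B v))\<^sup>2"
    using s(2) by simp
  have "0 \<le> inner (v - s *\<^sub>R B v) (B (v - s *\<^sub>R B v))"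
    by (rule nonneg)
  also have "\<dots> = inner v (B v) - 2 * s * (norm (B v))\<^sup>2 + s\<^sup>2 * inner (B v) (B (B v))"
    using sym[of v "B v"]
    by (simp add: blinfun.diff_right blinfun.scaleR_right inner_diff_left inner_diff_right
        power2_norm_eq_inner power2_eq_square[of s] inner_commute algebra_simps)
  finally have "s * (norm (B v))\<^sup>2 \<le> inner v (B v)"
    using 1 by linarith
  then show ?thesis
    using False by (simp add: s_def field_simps)
qed simp

lemma not_in_real_spectrumE:
  assumes "x \<notin> real_spectrum_on D T"
  obtains R :: "ell2 \<Rightarrow>\<^sub>L ell2" where "\<And>v. R v \<in> D" "\<And>v. T (R v) - x *\<^sub>R R v = v"
    "\<And>u. u \<in> D \<Longrightarrow> R (T u - x *\<^sub>R u) = u"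
  using assms unfolding real_spectrum_on_def spectrum_on_def by (auto simp: scaleR_ell2_cscale)

text \<open>The operator \<open>T\<close> may be unbounded, and it is not known beforehand to be bounded below, so the
  argument is carried out for a bounded resolvent. Suppose that there is no negative spectrum. For small
  \<open>c > 0\<close> the operator \<open>R = (T + c)\<^sup>-\<^sup>1\<close> is bounded and symmetric, and its form is negative at
  \<open>(T + c) \<phi>\<close>, so the infimum \<open>m\<close> of its numerical range is negative. By
  \<open>semidefinite_cauchy_schwarz\<close> the number \<open>m\<close> is approximately an eigenvalue of \<open>R\<close>, hence \<open>1/m - c\<close> is
  approximately one of \<open>T\<close>. But \<open>1/m - c\<close> is negative, hence in the resolvent set, which bounds \<open>R - m\<close>
  from below and contradicts the choice of \<open>m\<close>.\<close>

lemma negative_form_imp_negative_spectrum: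
  fixes T :: "ell2 \<Rightarrow> ell2"
  assumes sym: "\<And>u v. u \<in> D \<Longrightarrow> v \<in> D \<Longrightarrow> inner (T u) v = inner u (T v)"
    and \<phi>: "\<phi> \<in> D" "inner \<phi> (T \<phi>) < 0"
  shows "\<exists>x\<in>real_spectrum_on D T. x < 0"
proof (rule ccontr)
  assume no: "\<not> (\<exists>x\<in>real_spectrum_on D T. x < 0)"
  \<comment> \<open>Small enough that the form of \<open>T + c\<close> is still negative at \<open>\<phi>\<close>.\<close>
  define c where "c = - inner \<phi> (T \<phi>) / ((norm \<phi>)\<^sup>2 + 1)"
  have n1: "(norm \<phi>)\<^sup>2 + 1 > 0"
    by (simp add: add_nonneg_pos)
  have c: "c > 0"
    using \<phi>(2) n1 by (simp add: c_def divide_neg_pos)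
  have "inner \<phi> (T \<phi>) + c * (norm \<phi>)\<^sup>2 = inner \<phi> (T \<phi>) / ((norm \<phi>)\<^sup>2 + 1)"
    using n1 by (simp add: c_def field_simps)
  also have "\<dots> < 0"
    using \<phi>(2) n1 by (rule divide_neg_pos)
  finally have neg: "inner \<phi> (T \<phi>) + c * (norm \<phi>)\<^sup>2 < 0" .
  have "- c \<notin> real_spectrum_on D T"
    using no c by force
  then obtain R :: "ell2 \<Rightarrow>\<^sub>L ell2" where R: "\<And>v. R v \<in> D" "\<And>v. T (R v) + c *\<^sub>R R v = v"
    "\<And>u. u \<in> D \<Longrightarrow> R (T u + c *\<^sub>R u) = u"
    by (rule not_in_real_spectrumE) auto
  have symR: "inner (R v) w = inner v (R w)" for v w
  proof -
    have "inner (R v) w = inner (R v) (T (R w) + c *\<^sub>R R w)"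
      by (simp add: R)
    also have "\<dots> = inner (T (R v) + c *\<^sub>R R v) (R w)"
      using sym[OF R(1) R(1), of v w] by (simp add: inner_add_left inner_add_right)
    finally show ?thesis by (simp add: R)
  qed
  define S where "S = {inner v (R v) | v. norm v = 1}"
  define m where "m = Inf S"
  have "- norm R \<le> inner v (R v)" if "norm v = 1" for v
    using Cauchy_Schwarz_ineq2[of v "R v"] norm_blinfun[of R v] that by simp
  then have bdd: "bdd_below S"
    unfolding S_def by (auto intro!: bdd_belowI[of _ "- norm R"])
  define \<psi> where "\<psi> = T \<phi> + c *\<^sub>R \<phi>"
  have \<psi>R: "inner \<psi> (R \<psi>) < 0"
    using neg \<phi>(1) unfolding \<psi>_def R(3)[OF \<phi>(1)]
    by (simp add: inner_add_left inner_commute[of "T \<phi>"] power2_norm_eq_inner)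
  then have \<psi>0: "norm \<psi> > 0" by auto
  have \<psi>S: "inner \<psi> (R \<psi>) / (norm \<psi>)\<^sup>2 \<in> S"
    unfolding S_def using \<psi>0
    by (intro CollectI exI[of _ "\<psi> /\<^sub>R norm \<psi>"])
       (simp add: blinfun.scaleR_right power2_eq_square divide_inverse)
  have m: "m < 0"
    using cInf_lower[OF \<psi>S bdd] divide_neg_pos[OF \<psi>R, of "(norm \<psi>)\<^sup>2"] \<psi>0 unfolding m_def by simp
  define B where "B = R - m *\<^sub>R id_blinfun"
  have B: "B v = R v - m *\<^sub>R v" for v
    by (simp add: B_def blinfun.diff_left blinfun.scaleR_left)
  have Bform: "inner v (B v) = inner v (R v) - m * (norm v)\<^sup>2" for v
    by (simp add: B inner_diff_right power2_norm_eq_inner)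
  have "m * (norm v)\<^sup>2 \<le> inner v (R v)" for v
  proof (cases "v = 0")
    case False
    have "inner v (R v) / (norm v)\<^sup>2 \<in> S"
      unfolding S_def using False
      by (intro CollectI exI[of _ "v /\<^sub>R norm v"])
         (simp add: blinfun.scaleR_right power2_eq_square divide_inverse)
    then have "m \<le> inner v (R v) / (norm v)\<^sup>2"
      unfolding m_def by (rule cInf_lower[OF _ bdd])
    then show ?thesis
      using False by (simp add: field_simps)
  qed simp
  then have Bnonneg: "0 \<le> inner v (B v)" for v
    by (simp add: Bform)
  have Bsym: "inner (B v) w = inner v (B w)" for v w
    by (simp add: B inner_diff_left inner_diff_right symR)
  have "1 / m - c < 0"
    using c divide_pos_neg[of 1 m] m by linarith
  then have "1 / m - c \<notin> real_spectrum_on D T"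
    using no by force
  then obtain Q :: "ell2 \<Rightarrow>\<^sub>L ell2" where Q: "\<And>u. u \<in> D \<Longrightarrow> Q (T u - (1 / m - c) *\<^sub>R u) = u"
    by (rule not_in_real_spectrumE) auto
  define K where "K = (norm Q / \<bar>m\<bar> + 1) / \<bar>m\<bar>"
  have K: "K > 0"
    unfolding K_def using m by (intro divide_pos_pos add_nonneg_pos divide_nonneg_pos) auto
  have bound: "norm v \<le> K * norm (B v)" for v
  proof -
    \<comment> \<open>This computation is the identity \<open>(T - (1/m - c)) R = - (R - m) / m\<close>.\<close>
    have "T (R v) - (1 / m - c) *\<^sub>R R v = (T (R v) + c *\<^sub>R R v) - (1 / m) *\<^sub>R R v"
      by (simp add: algebra_simps)
    also have "\<dots> = (- 1 / m) *\<^sub>R B v"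
      using m by (simp add: R(2) B algebra_simps)
    finally have "R v = Q ((- 1 / m) *\<^sub>R B v)"
      using Q[OF R(1), of v] by simp
    then have "norm (R v) \<le> norm Q * (norm (B v) / \<bar>m\<bar>)"
      using norm_blinfun[of Q "(- 1 / m) *\<^sub>R B v"] by simp
    moreover have "\<bar>m\<bar> * norm v \<le> norm (R v) + norm (B v)"
      using norm_triangle_ineq4[of "R v" "B v"] by (simp add: B)
    ultimately have "norm v * \<bar>m\<bar> \<le> norm Q * (norm (B v) / \<bar>m\<bar>) + norm (B v)"
      by (simp add: mult.commute)
    then have "norm v \<le> (norm Q * (norm (B v) / \<bar>m\<bar>) + norm (B v)) / \<bar>m\<bar>"
      using m pos_le_divide_eq[of "\<bar>m\<bar>"] by simp
    then show ?thesis
      by (simp add: K_def add_divide_distrib distrib_right)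
  qed
  define \<kappa> where "\<kappa> = 1 / (K\<^sup>2 * (norm B + 1))"
  have KB: "K\<^sup>2 * (norm B + 1) > 0"
    using K by (simp add: add_nonneg_pos)
  have "m + \<kappa> \<le> inner v (R v)" if v: "norm v = 1" for v
  proof -
    have "1 \<le> (K * norm (B v))\<^sup>2"
      using power_mono[OF bound[of v], of 2] v by simp
    also have "\<dots> \<le> K\<^sup>2 * (norm B * inner v (B v))"
      unfolding power_mult_distrib by (intro mult_left_mono semidefinite_cauchy_schwarz Bsym Bnonneg) auto
    also have "\<dots> \<le> K\<^sup>2 * ((norm B + 1) * inner v (B v))"
      using Bnonneg[of v] by (intro mult_left_mono mult_right_mono) auto
    finally have "\<kappa> \<le> inner v (B v)"
      using KB by (simp add: \<kappa>_def divide_le_eq mult_ac)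
    then show ?thesis
      using v by (simp add: Bform)
  qed
  then have "m + \<kappa> \<le> m"
    unfolding m_def using \<psi>S by (intro cInf_greatest) (auto simp: S_def)
  then show False
    using KB by (simp add: \<kappa>_def divide_le_0_iff)
qed

section \<open>Potentials\<close>

lemma pot_op_inner_sums:
  assumes "v \<in> pot_domain V"
  shows "(\<lambda>k. V k * inner (Rep_ell2 u k) (Rep_ell2 v k)) sums inner u (pot_op V v)"
  using ell2_inner_sums[of u "pot_op V v"]
  by (simp add: pot_op_apply[OF assms] flip: scaleR_conv_of_real)

lemma pot_op_symmetric:
  assumes "u \<in> pot_domain V" "v \<in> pot_domain V"
  shows "inner (pot_op V u) v = inner u (pot_op V v)"
  using pot_op_inner_sums[OF assms(1), of v] pot_op_inner_sums[OF assms(2), of u]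
  by (simp add: inner_commute sums_unique2)

lemma finsupp_in_pot_domain:
  assumes "finsupp u"
  shows "u \<in> pot_domain V"
proof -
  obtain N where "\<And>k. k \<ge> N \<Longrightarrow> Rep_ell2 u k = 0"
    using assms finsuppE by metis
  then show ?thesis
    unfolding pot_domain_def by (intro CollectI summable_finite[of "{..<N}"]) auto
qed

lemma bounded_potential:
  assumes "\<And>k. \<bar>V k\<bar> \<le> c"
  shows "pot_domain V = UNIV" "bounded_linear (pot_op V)"
proof -
  have le: "(cmod (complex_of_real (V k) * Rep_ell2 u k))\<^sup>2 \<le> c\<^sup>2 * (cmod (Rep_ell2 u k))\<^sup>2" for u k
  proof -
    have "(V k)\<^sup>2 \<le> c\<^sup>2"
      using assms[of k] by (simp flip: abs_le_square_iff)
    then show ?thesis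
      by (simp add: norm_mult power_mult_distrib mult_right_mono)
  qed
  have sum: "summable (\<lambda>k. c\<^sup>2 * (cmod (Rep_ell2 u k))\<^sup>2)" for u
    by (intro summable_mult ell2_summable)
  show dom: "pot_domain V = UNIV"
    unfolding pot_domain_def
  proof (intro equalityI subset_UNIV subsetI CollectI)
    fix u :: ell2
    show "summable (\<lambda>k. (cmod (complex_of_real (V k) * Rep_ell2 u k))\<^sup>2)"
      by (rule summable_comparison_test'[OF sum[of u], of 0]) (simp add: le)
  qed
  have app: "Rep_ell2 (pot_op V u) k = complex_of_real (V k) * Rep_ell2 u k" for u k
    by (rule pot_op_apply) (simp add: dom)
  show "bounded_linear (pot_op V)"
  proof (rule bounded_linear_intro[where K = "\<bar>c\<bar>"])
    show "pot_op V (u + v) = pot_op V u + pot_op V v" for u v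
      by (simp add: Rep_ell2_inject[symmetric] fun_eq_iff plus_ell2.rep_eq app algebra_simps)
    show "pot_op V (r *\<^sub>R u) = r *\<^sub>R pot_op V u" for r u
      by (simp add: Rep_ell2_inject[symmetric] fun_eq_iff scaleR_ell2.rep_eq app algebra_simps)
    show "norm (pot_op V u) \<le> norm u * \<bar>c\<bar>" for u
    proof (rule power2_le_imp_le)
      have "(norm (pot_op V u))\<^sup>2 \<le> (\<Sum>k. c\<^sup>2 * (cmod (Rep_ell2 u k))\<^sup>2)"
        unfolding ell2_norm_sq using le
        by (intro suminf_le ell2_summable sum) (simp add: app)
      then show "(norm (pot_op V u))\<^sup>2 \<le> (norm u * \<bar>c\<bar>)\<^sup>2"
        by (simp add: ell2_norm_sq suminf_mult ell2_summable power_mult_distrib mult.commute)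
    qed simp
  qed
qed

text \<open>A finitely supported sequence lies in the domain of every potential, bounded or not. If its energy is
  below \<open>e \<bar>u\<^sub>n\<bar>\<^sup>2\<close> with \<open>e = - V\<^sub>n > 0\<close>, then \<open>H + V\<close> has negative form there, as the other values
  of \<open>V\<close> only lower it further.\<close>

lemma criticalI:
  fixes H :: "ell2 \<Rightarrow>\<^sub>L ell2"
  assumes H: "selfadjoint H"
    and small: "\<And>n e. n \<ge> 1 \<Longrightarrow> e > 0 \<Longrightarrow> \<exists>u. finsupp u \<and> inner u (H u) < e * (cmod (Rep_ell2 u n))\<^sup>2"
  shows "critical H"
  unfolding critical_def
proof (intro conjI allI impI H, elim conjE)
  fix V :: "nat \<Rightarrow> real"
  assume V: "\<forall>n\<ge>1. V n \<le> 0" and "\<exists>n\<ge>1. V n \<noteq> 0"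
  then obtain n where n: "n \<ge> 1" "V n < 0"
    by force
  then obtain u where u: "finsupp u" "inner u (H u) < - V n * (cmod (Rep_ell2 u n))\<^sup>2"
    using small[of n "- V n"] by auto
  note dom = finsupp_in_pot_domain[OF u(1), of V]
  have nonpos: "V k * inner (Rep_ell2 u k) (Rep_ell2 u k) \<le> 0" for k
    using V by (cases "k = 0") (auto intro: mult_nonpos_nonneg)
  have "inner u (pot_op V u) \<le> V n * (cmod (Rep_ell2 u n))\<^sup>2"
  proof (rule sums_le[OF _ pot_op_inner_sums[OF dom] sums_single[of n "\<lambda>k. V k * (cmod (Rep_ell2 u k))\<^sup>2"]])
    show "V k * inner (Rep_ell2 u k) (Rep_ell2 u k) \<le> (if k = n then V k * (cmod (Rep_ell2 u k))\<^sup>2 else 0)" for k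
      using nonpos[of k] by (simp add: power2_norm_eq_inner)
  qed
  then have neg: "inner u (H u + pot_op V u) < 0"
    using u(2) by (simp add: inner_add_right)
  have "\<exists>x\<in>real_spectrum_on (pot_domain V) (\<lambda>u. H u + pot_op V u). x < 0"
  proof (rule negative_form_imp_negative_spectrum[where T = "\<lambda>u. H u + pot_op V u", OF _ dom neg])
    have "inner (H u) v = inner u (H v)" for u v
      using H by (simp add: selfadjoint_def inner_ell2_def)
    then show "inner (H u + pot_op V u) v = inner u (H v + pot_op V v)"
      if "u \<in> pot_domain V" "v \<in> pot_domain V" for u v
      using pot_op_symmetric[OF that] by (simp add: inner_add_left inner_add_right)
  qed
  then show "(INF x\<in>real_spectrum_on (pot_domain V) (\<lambda>u. H u + pot_op V u). ereal x) < 0"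
    by (auto simp: INF_less_iff)
qed

text \<open>A lower bound of the energy by a single entry allows the potential \<open>- c \<delta>\<^sub>n\<close> to be added while the
  form stays nonnegative.\<close>

lemma not_criticalI:
  fixes H :: "ell2 \<Rightarrow>\<^sub>L ell2"
  assumes c: "c > 0" and n: "n \<ge> 1"
    and large: "\<And>u. finsupp u \<Longrightarrow> c * (cmod (Rep_ell2 u n))\<^sup>2 \<le> inner u (H u)"
  shows "\<not> critical H"
proof
  assume crit: "critical H"
  define V :: "nat \<Rightarrow> real" where "V = (\<lambda>k. if k = n then - c else 0)"
  have "\<bar>V k\<bar> \<le> c" for k
    using c by (simp add: V_def)
  note V = bounded_potential[OF this]
  have "(\<forall>k\<ge>1. V k \<le> 0) \<and> (\<exists>k\<ge>1. V k \<noteq> 0)"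
    using c n by (auto simp: V_def)
  then have "(INF x\<in>real_spectrum_on (pot_domain V) (\<lambda>u. H u + pot_op V u). ereal x) < 0"
    using crit unfolding critical_def by blast
  then have "(INF x\<in>real_spectrum_on UNIV (\<lambda>u. H u + pot_op V u). ereal x) < 0"
    by (simp only: V(1))
  then obtain x where x: "x \<in> real_spectrum_on UNIV (\<lambda>u. H u + pot_op V u)" "x < 0"
    by (auto simp: INF_less_iff)
  define B where "B = H + Blinfun (pot_op V)"
  have B: "B u = H u + pot_op V u" for u
    by (simp add: B_def blinfun.add_left bounded_linear_Blinfun_apply V)
  have "inner u (pot_op V u) = - c * (cmod (Rep_ell2 u n))\<^sup>2" for u
  proof (rule sums_unique2[OF pot_op_inner_sums])
    show "(\<lambda>k. V k * inner (Rep_ell2 u k) (Rep_ell2 u k)) sums (- c * (cmod (Rep_ell2 u n))\<^sup>2)"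
      using sums_single[of n "\<lambda>k. - c * (cmod (Rep_ell2 u k))\<^sup>2"]
      by (simp add: V_def power2_norm_eq_inner if_distrib[of "\<lambda>x. x * _"] cong: if_cong)
  qed (simp add: V)
  then have fin: "0 \<le> inner u (B u)" if "finsupp u" for u
    using large[OF that] by (simp add: B inner_add_right)
  have "0 \<le> inner u (B u)" for u
    by (rule le_by_finsupp[of "\<lambda>_. 0" "\<lambda>u. inner u (B u)"]) (auto intro!: tendsto_intros fin)
  from nonneg_imp_neg_not_in_real_spectrum[OF this x(2)] x(1) show False
    by (simp add: B[abs_def])
qed

section \<open>Elementary estimates of the symbol and of integrals\<close>

text \<open>A weak form of Jordan's inequality. The mean value theorem gives \<open>y cos y \<le> sin y\<close>; at \<open>y = x / 2\<close>,
  where the cosine is at least \<open>cos (\<pi> / 4)\<close>, the formula \<open>sin x = 2 sin y cos y\<close> does the rest.\<close>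

lemma half_le_sin:
  fixes x :: real
  assumes "0 \<le> x" "x \<le> pi / 2"
  shows "x / 2 \<le> sin x"
proof -
  have *: "y * cos y \<le> sin y" if y: "0 < y" "y \<le> pi" for y :: real
  proof -
    obtain z where z: "0 < z" "z < y" "sin y - sin 0 = (y - 0) * cos z"
      using MVT2[of 0 y sin cos] y by (auto intro: DERIV_sin)
    then show ?thesis
      using y cos_monotone_0_pi_le[of z y] by (simp add: mult_left_mono)
  qed
  show ?thesis
  proof (cases "x = 0")
    case False
    let ?y = "x / 2"
    have y: "0 < ?y" "?y \<le> pi / 4"
      using assms False by auto
    have "cos (pi / 4) \<le> cos ?y"
      using y by (intro cos_monotone_0_pi_le) auto
    then have c: "sqrt 2 / 2 \<le> cos ?y"
      by (simp add: cos_45)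
    then have c2: "1 / 2 \<le> (cos ?y)\<^sup>2"
      using power_mono[OF c, of 2] by (simp add: power_divide)
    have "x / 2 \<le> x * (cos ?y)\<^sup>2"
      using mult_left_mono[OF c2, of x] assms by simp
    also have "\<dots> = 2 * (?y * cos ?y) * cos ?y"
      by (simp add: power2_eq_square)
    also have "\<dots> \<le> 2 * sin ?y * cos ?y"
      using *[of ?y] y c by (intro mult_right_mono mult_left_mono order_trans[OF _ c]) auto
    also have "\<dots> = sin x"
      using sin_double[of ?y] by simp
    finally show ?thesis .
  qed simp
qed

lemma symbol_eq: "symbol \<theta> = (2 * sin (\<theta> / 2))\<^sup>2"
  using cos_double_sin[of "\<theta> / 2"] by (simp add: symbol_def power_mult_distrib)

lemma symbol_le: "symbol \<theta> \<le> \<theta>\<^sup>2"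
  using abs_sin_x_le_abs_x[of "\<theta> / 2"] unfolding symbol_eq abs_le_square_iff[symmetric]
  by (simp add: abs_mult)

lemma symbol_ge:
  assumes "0 \<le> \<theta>" "\<theta> \<le> pi"
  shows "(\<theta> / 2)\<^sup>2 \<le> symbol \<theta>"
  unfolding symbol_eq using half_le_sin[of "\<theta> / 2"] assms by (intro power_mono) auto

text \<open>By orthogonality only the term \<open>k = n\<close> of the transform contributes. This is how a single entry of
  a sequence enters the estimates on the transform side.\<close>

lemma has_integral_sine_coefficient:
  assumes "finsupp u" "n \<ge> 1"
  shows "((\<lambda>\<theta>. sin (real n * \<theta>) *\<^sub>R sine_transform u \<theta>) has_integral ((pi / 2) *\<^sub>R Rep_ell2 u n)) {0..pi}"
proof -
  obtain M where "\<And>k. k \<ge> M \<Longrightarrow> Rep_ell2 u k = 0"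
    using assms finsuppE by metis
  then have N: "\<And>k. k \<ge> max M (Suc n) \<Longrightarrow> Rep_ell2 u k = 0"
    by simp
  let ?N = "max M (Suc n)"
  have coeff: "((\<lambda>\<theta>. (sin (real n * \<theta>) * sin (real k * \<theta>)) *\<^sub>R Rep_ell2 u k) has_integral
      (if n = k then pi / 2 else 0) *\<^sub>R Rep_ell2 u k) {0..pi}" for k
  proof (cases "k = 0")
    case False
    then show ?thesis
      by (intro has_integral_scaleR_left sine_orthogonality assms) auto
  qed simp
  have "((\<lambda>\<theta>. \<Sum>k<?N. (sin (real n * \<theta>) * sin (real k * \<theta>)) *\<^sub>R Rep_ell2 u k) has_integral
      (\<Sum>k<?N. (if n = k then pi / 2 else 0) *\<^sub>R Rep_ell2 u k)) {0..pi}"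
    by (intro has_integral_sum coeff) simp
  moreover have "(\<Sum>k<?N. (if n = k then pi / 2 else 0) *\<^sub>R Rep_ell2 u k) = (pi / 2) *\<^sub>R Rep_ell2 u n"
    by (simp add: if_distrib[of "\<lambda>x. x *\<^sub>R _"] sum.delta cong: if_cong)
  moreover have "sine_transform u \<theta> = (\<Sum>k<?N. sin (real k * \<theta>) *\<^sub>R Rep_ell2 u k)" for \<theta>
    by (rule sine_transform_eq_sum) (rule N)
  ultimately show ?thesis
    by (simp add: scaleR_sum_right)
qed

lemma continuous_on_fun_symbol:
  assumes "continuous_on {0..4} f"
  shows "continuous_on S (\<lambda>\<theta>. f (symbol \<theta>))"
  by (rule continuous_on_compose2[OF assms continuous_on_symbol]) (auto simp: symbol_bounds)

text \<open>Optimising over \<open>t\<close> recovers the Cauchy-Schwarz inequality from Young's inequality.\<close>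

lemma square_le_if_le_all_scalings:
  fixes b E D :: real
  assumes "D > 0" "b \<ge> 0" "E \<ge> 0" "\<And>t. t > 0 \<Longrightarrow> b \<le> t * E + D / t"
  shows "b\<^sup>2 \<le> 4 * D * E"
proof (cases "b = 0")
  case True
  then show ?thesis
    using assms(1,3) by simp
next
  case False
  then have b: "b > 0" using assms(2) by simp
  have "b \<le> 2 * D / b * E + b / 2"
    using assms(4)[of "2 * D / b"] assms(1) b by simp
  then have "b * b \<le> b * (2 * D / b * E + b / 2)"
    using b by (intro mult_left_mono) auto
  then show ?thesis
    using b by (simp add: power2_eq_square distrib_left)
qed

section \<open>The energy of the fractional Laplacian\<close>

lemma frac_laplacian_form:
  assumes "\<alpha> > 0" "finsupp u"
  shows "pi / 2 * inner u (frac_laplacian \<alpha> u)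
    = integral {0..pi} (\<lambda>\<theta>. symbol \<theta> powr \<alpha> * (cmod (sine_transform u \<theta>))\<^sup>2)"
  unfolding frac_laplacian_def by (intro fun_calc_form continuous_on_powr_nonneg assms)

lemma young_pointwise:
  fixes a b w t :: real
  assumes "w > 0" "t > 0"
  shows "2 * (a * b) \<le> t * (w * b\<^sup>2) + a\<^sup>2 / w / t"
proof -
  have "0 \<le> (t * w * b - a)\<^sup>2 / (t * w)"
    using assms by simp
  also have "\<dots> = t * (w * b\<^sup>2) + a\<^sup>2 / w / t - 2 * (a * b)"
    using assms by (simp add: power2_eq_square field_simps)
  finally show ?thesis by simp
qed

text \<open>The Hardy inequality for \<open>\<alpha> < 3/2\<close>. By Cauchy-Schwarz with the weight \<open>symbol\<^sup>\<alpha>\<close>, the first sine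
  coefficient is controlled by the energy as soon as \<open>sin\<^sup>2 \<theta> / symbol\<^sup>\<alpha>\<close> is integrable; it is
  of order \<open>\<theta>\<close> to the power \<open>2 - 2 \<alpha>\<close> near 0, and \<open>2 - 2 \<alpha> > - 1\<close>. Cauchy-Schwarz is used in the form of
  Young's inequality with a parameter \<open>t\<close>, so that only an integrable upper bound of this singular function
  has to be integrated.\<close>

lemma frac_laplacian_hardy:
  assumes \<alpha>: "\<alpha> > 0" "\<alpha> < 3 / 2"
  obtains c where "c > 0" "\<And>u. finsupp u \<Longrightarrow> c * (cmod (Rep_ell2 u 1))\<^sup>2 \<le> inner u (frac_laplacian \<alpha> u)"
proof -
  define D where "D = 4 powr \<alpha> * (pi powr (3 - 2 * \<alpha>) / (3 - 2 * \<alpha>))"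
  have D: "D > 0"
    using \<alpha> by (auto simp: D_def intro!: mult_pos_pos divide_pos_pos)
  have int: "((\<lambda>\<theta>. 4 powr \<alpha> * \<theta> powr (2 - 2 * \<alpha>)) has_integral D) {0..pi}"
    using has_integral_mult_right[OF has_integral_powr_from_0[of "2 - 2 * \<alpha>" pi], of "4 powr \<alpha>"] \<alpha>
    by (simp add: D_def)
  have quot: "(sin \<theta>)\<^sup>2 / symbol \<theta> powr \<alpha> \<le> 4 powr \<alpha> * \<theta> powr (2 - 2 * \<alpha>)" "symbol \<theta> > 0"
    if \<theta>: "0 < \<theta>" "\<theta> \<le> pi" for \<theta>
  proof -
    have ge: "(\<theta> / 2)\<^sup>2 \<le> symbol \<theta>"
      using symbol_ge[of \<theta>] \<theta> by simp
    have pos: "0 < (\<theta> / 2)\<^sup>2"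
      using \<theta> by simp
    show "symbol \<theta> > 0"
      using ge pos by linarith
    have pw: "((\<theta> / 2)\<^sup>2) powr \<alpha> = \<theta> powr (2 * \<alpha>) / 4 powr \<alpha>"
      using \<theta> by (simp add: power_divide powr_divide powr_powr flip: powr_numeral)
    have "(sin \<theta>)\<^sup>2 / symbol \<theta> powr \<alpha> \<le> \<theta>\<^sup>2 / ((\<theta> / 2)\<^sup>2) powr \<alpha>"
    proof (rule frac_le)
      show "(sin \<theta>)\<^sup>2 \<le> \<theta>\<^sup>2"
        using abs_sin_x_le_abs_x[of \<theta>] by (simp flip: abs_le_square_iff)
      show "((\<theta> / 2)\<^sup>2) powr \<alpha> \<le> symbol \<theta> powr \<alpha>"
        using ge \<alpha> by (intro powr_mono2) auto
    qed (use \<theta> in auto)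
    also have "\<dots> = 4 powr \<alpha> * \<theta> powr (2 - 2 * \<alpha>)"
      unfolding pw using \<theta> by (simp add: powr_diff powr_numeral)
    finally show "(sin \<theta>)\<^sup>2 / symbol \<theta> powr \<alpha> \<le> 4 powr \<alpha> * \<theta> powr (2 - 2 * \<alpha>)" .
  qed
  have main: "pi / (2 * D) * (cmod (Rep_ell2 u 1))\<^sup>2 \<le> inner u (frac_laplacian \<alpha> u)" if u: "finsupp u" for u
  proof -
    let ?h = "\<lambda>\<theta>. (cmod (sine_transform u \<theta>))\<^sup>2"
    define E where "E = integral {0..pi} (\<lambda>\<theta>. symbol \<theta> powr \<alpha> * ?h \<theta>)"
    have E: "((\<lambda>\<theta>. symbol \<theta> powr \<alpha> * ?h \<theta>) has_integral E) {0..pi}"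
      unfolding E_def
      by (intro integrable_integral integrable_continuous_real continuous_intros
          continuous_on_fun_symbol[OF continuous_on_powr_nonneg] \<alpha> u)
    have E0: "E \<ge> 0"
      by (rule has_integral_nonneg[OF E]) simp
    have "pi * cmod (Rep_ell2 u 1) \<le> t * E + D / t" if t: "t > 0" for t
    proof -
      have L: "((\<lambda>\<theta>. 2 *\<^sub>R (sin \<theta> *\<^sub>R sine_transform u \<theta>)) has_integral 2 *\<^sub>R ((pi / 2) *\<^sub>R Rep_ell2 u 1)) {0..pi}"
        using has_integral_sine_coefficient[OF u, of 1] by (intro has_integral_cmul) simp
      have R: "((\<lambda>\<theta>. t * (symbol \<theta> powr \<alpha> * ?h \<theta>) + 4 powr \<alpha> * \<theta> powr (2 - 2 * \<alpha>) / t) has_integral t * E + D / t) {0..pi}"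
        by (intro has_integral_add has_integral_mult_right has_integral_divide E int)
      have "norm (2 *\<^sub>R (sin \<theta> *\<^sub>R sine_transform u \<theta>))
          \<le> t * (symbol \<theta> powr \<alpha> * ?h \<theta>) + 4 powr \<alpha> * \<theta> powr (2 - 2 * \<alpha>) / t"
        if \<theta>: "\<theta> \<in> {0..pi}" for \<theta>
      proof (cases "\<theta> = 0")
        case True
        then show ?thesis using t by simp
      next
        case False
        then have \<theta>': "0 < \<theta>" "\<theta> \<le> pi" using \<theta> by auto
        have "2 * (\<bar>sin \<theta>\<bar> * cmod (sine_transform u \<theta>))
            \<le> t * (symbol \<theta> powr \<alpha> * ?h \<theta>) + \<bar>sin \<theta>\<bar>\<^sup>2 / symbol \<theta> powr \<alpha> / t"
          using quot(2)[OF \<theta>'] t by (intro young_pointwise) auto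
        moreover have "\<bar>sin \<theta>\<bar>\<^sup>2 / symbol \<theta> powr \<alpha> / t \<le> 4 powr \<alpha> * \<theta> powr (2 - 2 * \<alpha>) / t"
          using quot(1)[OF \<theta>'] t by (intro divide_right_mono) auto
        ultimately show ?thesis
          by simp
      qed
      then have "norm (integral {0..pi} (\<lambda>\<theta>. 2 *\<^sub>R (sin \<theta> *\<^sub>R sine_transform u \<theta>))) \<le>
          integral {0..pi} (\<lambda>\<theta>. t * (symbol \<theta> powr \<alpha> * ?h \<theta>) + 4 powr \<alpha> * \<theta> powr (2 - 2 * \<alpha>) / t)"
        using L R by (intro integral_norm_bound_integral) auto
      then show ?thesis
        unfolding integral_unique[OF L] integral_unique[OF R] by simp
    qed
    then have "(pi * cmod (Rep_ell2 u 1))\<^sup>2 \<le> 4 * D * E"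
      by (intro square_le_if_le_all_scalings D E0) auto
    moreover have "E = pi / 2 * inner u (frac_laplacian \<alpha> u)"
      unfolding E_def frac_laplacian_form[OF \<alpha>(1) u] ..
    ultimately have "pi * (pi * (cmod (Rep_ell2 u 1))\<^sup>2) \<le> pi * (2 * D * inner u (frac_laplacian \<alpha> u))"
      by (simp add: power2_eq_square mult_ac)
    then have "pi * (cmod (Rep_ell2 u 1))\<^sup>2 \<le> 2 * D * inner u (frac_laplacian \<alpha> u)"
      using mult_le_cancel_left_pos[OF pi_gt_zero] by blast
    then show ?thesis
      using D by (simp add: field_simps)
  qed
  show ?thesis
    using D main by (intro that[of "pi / (2 * D)"]) auto
qed

text \<open>The unit vectors. As index 0 carries no entry, \<open>delta 0\<close> is the zero sequence.\<close>

lift_definition delta :: "nat \<Rightarrow> ell2" is "\<lambda>n k. if k = n \<and> n \<noteq> 0 then 1 else 0"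
proof
  fix n :: nat
  show "summable (\<lambda>k. (cmod (if k = n \<and> n \<noteq> 0 then 1 else 0))\<^sup>2)"
    by (rule summable_finite[of "{n}"]) auto
qed auto

lemma finsupp_delta: "finsupp (delta n)"
  unfolding finsupp_def by (rule exI[of _ "Suc n"]) (simp add: delta.rep_eq)

lemma sine_transform_delta:
  assumes "n \<ge> 1"
  shows "sine_transform (delta n) \<theta> = complex_of_real (sin (real n * \<theta>))"
  using assms sine_transform_eq_sum[of "Suc n" "delta n" \<theta>]
  by (simp add: delta.rep_eq if_distrib[of "\<lambda>x. _ *\<^sub>R x"] scaleR_conv_of_real cong: if_cong)

text \<open>A Hardy inequality at the site \<open>n\<close>, tested on \<open>q(A) \<delta>\<^sub>n\<close> for polynomials \<open>q\<close>, becomes an inequality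
  between integrals, which extends to every continuous \<open>g\<close> by uniform approximation. Polynomials are used
  because they keep the trial sequence finitely supported.\<close>

lemma hardy_imp_weighted_integral_le:
  assumes \<alpha>: "\<alpha> > 0" and n: "n \<ge> 1" and \<epsilon>: "\<epsilon> > 0"
    and le: "\<And>u. finsupp u \<Longrightarrow> \<epsilon> * (cmod (Rep_ell2 u n))\<^sup>2 \<le> inner u (frac_laplacian \<alpha> u)"
    and g: "continuous_on {0..4} g"
  shows "2 * \<epsilon> * (integral {0..pi} (\<lambda>\<theta>. g (symbol \<theta>) * (sin (real n * \<theta>))\<^sup>2))\<^sup>2
    \<le> pi * integral {0..pi} (\<lambda>\<theta>. (g (symbol \<theta>))\<^sup>2 * (symbol \<theta> powr \<alpha> * (sin (real n * \<theta>))\<^sup>2))"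
proof -
  let ?s = "\<lambda>\<theta>. (sin (real n * \<theta>))\<^sup>2"
  have poly: "2 * \<epsilon> * (integral {0..pi} (\<lambda>\<theta>. poly q (symbol \<theta>) * ?s \<theta>))\<^sup>2
    \<le> pi * integral {0..pi} (\<lambda>\<theta>. poly (q * q) (symbol \<theta>) * (symbol \<theta> powr \<alpha> * ?s \<theta>))" for q
  proof -
    define u where "u = blinfun_poly q neg_laplacian (delta n)"
    have u: "finsupp u" "sine_transform u \<theta> = complex_of_real (poly q (symbol \<theta>) * sin (real n * \<theta>))" for \<theta>
      unfolding u_def using n
      by (simp_all add: finsupp_poly finsupp_delta sine_transform_poly sine_transform_delta scaleR_conv_of_real)
    define I where "I = integral {0..pi} (\<lambda>\<theta>. poly q (symbol \<theta>) * ?s \<theta>)"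
    have "((\<lambda>\<theta>. poly q (symbol \<theta>) * ?s \<theta>) has_integral I) {0..pi}"
      unfolding I_def by (intro integrable_integral integrable_continuous_real continuous_intros)
    then have "((\<lambda>\<theta>. complex_of_real (poly q (symbol \<theta>) * ?s \<theta>)) has_integral of_real I) {0..pi}"
      by (rule has_integral_of_real)
    moreover have "((\<lambda>\<theta>. complex_of_real (poly q (symbol \<theta>) * ?s \<theta>)) has_integral ((pi / 2) *\<^sub>R Rep_ell2 u n)) {0..pi}"
      using has_integral_sine_coefficient[OF u(1) n]
      by (simp add: u(2) scaleR_conv_of_real power2_eq_square mult_ac)
    ultimately have "(pi / 2) *\<^sub>R Rep_ell2 u n = of_real I"
      by (rule has_integral_unique[rotated])
    then have "norm ((pi / 2) *\<^sub>R Rep_ell2 u n) = norm (complex_of_real I)"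
      by (rule arg_cong)
    then have "pi / 2 * cmod (Rep_ell2 u n) = \<bar>I\<bar>"
      by simp
    then have I: "I\<^sup>2 = (pi / 2)\<^sup>2 * (cmod (Rep_ell2 u n))\<^sup>2"
      by (metis power2_abs power_mult_distrib)
    have "2 * \<epsilon> * I\<^sup>2 = pi\<^sup>2 / 2 * (\<epsilon> * (cmod (Rep_ell2 u n))\<^sup>2)"
      by (simp add: I power_divide)
    also have "\<dots> \<le> pi\<^sup>2 / 2 * inner u (frac_laplacian \<alpha> u)"
      by (intro mult_left_mono le u) auto
    also have "\<dots> = pi * (pi / 2 * inner u (frac_laplacian \<alpha> u))"
      by (simp add: power2_eq_square)
    also have "\<dots> = pi * integral {0..pi} (\<lambda>\<theta>. poly (q * q) (symbol \<theta>) * (symbol \<theta> powr \<alpha> * ?s \<theta>))"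
      unfolding frac_laplacian_form[OF \<alpha> u(1)] u(2)
      by (simp add: norm_mult power_mult_distrib power2_eq_square[of "poly q _"] mult_ac)
    finally show ?thesis
      by (simp add: I_def)
  qed
  obtain p where p: "uniform_limit {0..4} (\<lambda>k x. poly (p k) x) g sequentially"
    using Weierstrass_poly_sequence[OF compact_Icc g] .
  have "uniform_limit {0..4} (\<lambda>k x. poly (p k) x * poly (p k) x) (\<lambda>x. g x * g x) sequentially"
    by (intro uniform_lim_mult p compact_imp_bounded compact_continuous_image g compact_Icc)
  then have pp: "uniform_limit {0..4} (\<lambda>k x. poly (p k * p k) x) (\<lambda>x. (g x)\<^sup>2) sequentially"
    by (simp add: power2_eq_square)
  show ?thesis
  proof (rule LIMSEQ_le)
    show "(\<lambda>k. 2 * \<epsilon> * (integral {0..pi} (\<lambda>\<theta>. poly (p k) (symbol \<theta>) * ?s \<theta>))\<^sup>2) \<longlonglongrightarrow>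
        2 * \<epsilon> * (integral {0..pi} (\<lambda>\<theta>. g (symbol \<theta>) * ?s \<theta>))\<^sup>2"
      by (intro tendsto_intros uniform_limit_integral_weight p g continuous_intros)
    show "(\<lambda>k. pi * integral {0..pi} (\<lambda>\<theta>. poly (p k * p k) (symbol \<theta>) * (symbol \<theta> powr \<alpha> * ?s \<theta>))) \<longlonglongrightarrow>
        pi * integral {0..pi} (\<lambda>\<theta>. (g (symbol \<theta>))\<^sup>2 * (symbol \<theta> powr \<alpha> * ?s \<theta>))"
      by (intro tendsto_intros uniform_limit_integral_weight[OF pp] g continuous_intros
          continuous_on_fun_symbol[OF continuous_on_powr_nonneg] \<alpha>)
    show "\<exists>N. \<forall>k\<ge>N. 2 * \<epsilon> * (integral {0..pi} (\<lambda>\<theta>. poly (p k) (symbol \<theta>) * ?s \<theta>))\<^sup>2 \<le>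
        pi * integral {0..pi} (\<lambda>\<theta>. poly (p k * p k) (symbol \<theta>) * (symbol \<theta> powr \<alpha> * ?s \<theta>))"
      using poly by blast
  qed
qed

text \<open>For \<open>\<alpha> \<ge> 3/2\<close> this integral diverges at least logarithmically as \<open>\<delta> \<rightarrow> 0\<close>. On \<open>[0, 1/n]\<close> one has
  \<open>symbol\<^sup>\<alpha> \<le> \<theta>\<^sup>3\<close> and \<open>sin\<^sup>2 (n \<theta>) \<ge> \<theta>\<^sup>2 / 4\<close>, and \<open>\<theta>\<^sup>2 / (4 (\<theta>\<^sup>3 + \<delta>))\<close> has the
  primitive \<open>ln (\<theta>\<^sup>3 + \<delta>) / 12\<close>.\<close>

lemma regularised_weight_integral_ge:
  assumes \<alpha>: "\<alpha> \<ge> 3 / 2" and n: "n \<ge> 1" and \<delta>: "\<delta> > 0"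
  shows "(ln (1 / real n ^ 3 + \<delta>) - ln \<delta>) / 12
    \<le> integral {0..pi} (\<lambda>\<theta>. 1 / (symbol \<theta> powr \<alpha> + \<delta>) * (sin (real n * \<theta>))\<^sup>2)"
proof -
  let ?a = "1 / real n" and ?F = "\<lambda>\<theta>. 1 / (symbol \<theta> powr \<alpha> + \<delta>) * (sin (real n * \<theta>))\<^sup>2"
  have a: "0 < ?a" "?a \<le> 1"
    using n by (auto simp: divide_le_eq)
  then have a_pi: "?a \<le> pi"
    using pi_gt3 by linarith
  have nz: "symbol \<theta> powr \<alpha> + \<delta> > 0" for \<theta>
    using \<delta> by (simp add: add_nonneg_pos)
  have cont: "continuous_on S ?F" for S
    using nz \<alpha>
    by (intro continuous_intros continuous_on_fun_symbol[OF continuous_on_powr_nonneg]) (auto simp: less_imp_neq[symmetric])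
  have "((\<lambda>\<theta>. \<theta>\<^sup>2 / (4 * (\<theta> ^ 3 + \<delta>))) has_integral (1 / 12 * ln (?a ^ 3 + \<delta>) - 1 / 12 * ln (0 ^ 3 + \<delta>))) {0..?a}"
  proof (rule fundamental_theorem_of_calculus)
    fix \<theta> assume "\<theta> \<in> {0..?a}"
    then have "\<theta> ^ 3 + \<delta> > 0" using \<delta> by (simp add: add_nonneg_pos)
    then show "((\<lambda>\<theta>. 1 / 12 * ln (\<theta> ^ 3 + \<delta>)) has_vector_derivative \<theta>\<^sup>2 / (4 * (\<theta> ^ 3 + \<delta>))) (at \<theta> within {0..?a})"
      by (auto intro!: derivative_eq_intros simp flip: has_real_derivative_iff_has_vector_derivative)
         (subst frac_eq_eq; auto simp: algebra_simps)
  qed (use a in simp)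
  moreover have "(?F has_integral integral {0..?a} ?F) {0..?a}"
    by (intro integrable_integral integrable_continuous_real cont)
  moreover have "\<theta>\<^sup>2 / (4 * (\<theta> ^ 3 + \<delta>)) \<le> ?F \<theta>" if "\<theta> \<in> {0..?a}" for \<theta>
  proof -
    have \<theta>: "0 \<le> \<theta>" "\<theta> \<le> ?a" "\<theta> \<le> 1"
      using that order_trans[OF _ a(2), of \<theta>] by auto
    have n\<theta>: "\<theta> \<le> real n * \<theta>" "real n * \<theta> \<le> 1"
      using \<theta> n mult_right_mono[of 1 "real n" \<theta>] by (auto simp: field_simps)
    have "real n * \<theta> / 2 \<le> sin (real n * \<theta>)"
      using n\<theta> \<theta> pi_gt3 by (intro half_le_sin) auto
    then have "\<theta> / 2 \<le> sin (real n * \<theta>)"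
      using n\<theta> by linarith
    from power_mono[OF this, of 2] have s: "\<theta>\<^sup>2 / 4 \<le> (sin (real n * \<theta>))\<^sup>2"
      using \<theta> by (simp add: power_divide)
    have "symbol \<theta> powr \<alpha> \<le> (\<theta>\<^sup>2) powr \<alpha>"
      using symbol_bounds symbol_le \<alpha> by (intro powr_mono2) auto
    also have "\<dots> \<le> (\<theta>\<^sup>2) powr (3 / 2)"
      using \<theta> \<alpha> by (intro powr_mono') (auto simp: power_le_one)
    also have "\<dots> = \<theta> ^ 3"
    proof (cases "\<theta> = 0")
      case False
      then have "(\<theta>\<^sup>2) powr (3 / 2) = (\<theta> powr 2) powr (3 / 2)"
        using \<theta> by (simp add: powr_numeral)
      also have "\<dots> = \<theta> powr 3"
        by (simp add: powr_powr)
      finally show ?thesis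
        using \<theta> False by (simp add: powr_numeral)
    qed simp
    finally have w: "symbol \<theta> powr \<alpha> + \<delta> \<le> \<theta> ^ 3 + \<delta>" by simp
    have "\<theta>\<^sup>2 / 4 / (\<theta> ^ 3 + \<delta>) \<le> (sin (real n * \<theta>))\<^sup>2 / (symbol \<theta> powr \<alpha> + \<delta>)"
      by (intro frac_le s w nz) auto
    then show ?thesis by simp
  qed
  ultimately have "1 / 12 * ln (?a ^ 3 + \<delta>) - 1 / 12 * ln (0 ^ 3 + \<delta>) \<le> integral {0..?a} ?F"
    by (rule has_integral_le)
  also have "\<dots> \<le> integral {0..pi} ?F"
    using a_pi nz by (intro integral_subset_le integrable_continuous_real cont) (auto simp: less_imp_le)
  finally show ?thesis
    by (simp add: power_divide diff_divide_distrib)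
qed

text \<open>Suppose that a Hardy inequality holds at the site \<open>n\<close>. The choice \<open>g(x) = 1 / (x\<^sup>\<alpha> + \<delta>)\<close> satisfies
  \<open>g\<^sup>2 x\<^sup>\<alpha> \<le> g\<close>, so that both sides of \<open>hardy_imp_weighted_integral_le\<close> are controlled by the same integral \<open>I\<close> and
  \<open>I\<close> is bounded by a constant independent of \<open>\<delta>\<close>. This contradicts the logarithmic divergence.\<close>

lemma frac_laplacian_small_energy:
  assumes \<alpha>: "\<alpha> \<ge> 3 / 2" and n: "n \<ge> 1" and \<epsilon>: "\<epsilon> > 0"
  shows "\<exists>u. finsupp u \<and> inner u (frac_laplacian \<alpha> u) < \<epsilon> * (cmod (Rep_ell2 u n))\<^sup>2"
proof (rule ccontr)
  assume "\<not> ?thesis"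
  then have le: "\<epsilon> * (cmod (Rep_ell2 u n))\<^sup>2 \<le> inner u (frac_laplacian \<alpha> u)" if "finsupp u" for u
    using that by force
  have \<alpha>0: "\<alpha> > 0" using \<alpha> by simp
  let ?s = "\<lambda>\<theta>. (sin (real n * \<theta>))\<^sup>2"
  have bound: "integral {0..pi} (\<lambda>\<theta>. 1 / (symbol \<theta> powr \<alpha> + \<delta>) * ?s \<theta>) \<le> pi / (2 * \<epsilon>)" if \<delta>: "\<delta> > 0" for \<delta>
  proof -
    let ?g = "\<lambda>x :: real. 1 / (x powr \<alpha> + \<delta>)"
    define I where "I = integral {0..pi} (\<lambda>\<theta>. ?g (symbol \<theta>) * ?s \<theta>)"
    have nz: "x powr \<alpha> + \<delta> > 0" for x
      using \<delta> by (simp add: add_nonneg_pos)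
    have g: "continuous_on {0..4} ?g"
      using nz by (intro continuous_intros continuous_on_powr_nonneg \<alpha>0) (auto simp: less_imp_neq[symmetric])
    have cg: "continuous_on S (\<lambda>\<theta>. ?g (symbol \<theta>))" for S
      by (rule continuous_on_fun_symbol[OF g])
    have cw: "continuous_on S (\<lambda>\<theta>. symbol \<theta> powr \<alpha>)" for S
      by (rule continuous_on_fun_symbol[OF continuous_on_powr_nonneg[OF \<alpha>0]])
    have int: "(\<lambda>\<theta>. (?g (symbol \<theta>))\<^sup>2 * (symbol \<theta> powr \<alpha> * ?s \<theta>)) integrable_on {0..pi}"
      "(\<lambda>\<theta>. ?g (symbol \<theta>) * ?s \<theta>) integrable_on {0..pi}"
      by (intro integrable_continuous_real continuous_on_mult continuous_on_power cg cw continuous_intros)+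
    have "2 * \<epsilon> * I\<^sup>2 \<le> pi * integral {0..pi} (\<lambda>\<theta>. (?g (symbol \<theta>))\<^sup>2 * (symbol \<theta> powr \<alpha> * ?s \<theta>))"
      unfolding I_def by (rule hardy_imp_weighted_integral_le[OF \<alpha>0 n \<epsilon> le g])
    also have "\<dots> \<le> pi * I"
      unfolding I_def
    proof (intro mult_left_mono integral_le int)
      fix \<theta> :: real
      have "(?g (symbol \<theta>))\<^sup>2 * symbol \<theta> powr \<alpha> \<le> ?g (symbol \<theta>)"
        using nz[of "symbol \<theta>"] \<delta> by (simp add: power2_eq_square divide_simps)
      from mult_right_mono[OF this, of "?s \<theta>"]
      show "(?g (symbol \<theta>))\<^sup>2 * (symbol \<theta> powr \<alpha> * ?s \<theta>) \<le> ?g (symbol \<theta>) * ?s \<theta>"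
        by (simp add: mult_ac)
    qed simp
    finally have *: "2 * \<epsilon> * I\<^sup>2 \<le> pi * I" .
    show ?thesis
    proof (cases "I \<le> 0")
      case True
      then show ?thesis
        using order_trans[OF True, of "pi / (2 * \<epsilon>)"] \<epsilon> unfolding I_def[symmetric] by simp
    next
      case False
      then have "I * (2 * \<epsilon> * I) \<le> I * pi"
        using * by (simp add: power2_eq_square mult_ac)
      then have "2 * \<epsilon> * I \<le> pi"
        using False by (simp add: mult_le_cancel_left_pos)
      then show ?thesis
        using \<epsilon> unfolding I_def[symmetric] by (simp add: field_simps)
    qed
  qed
  \<comment> \<open>The logarithm is made to exceed the bound by choosing \<open>\<delta>\<close> exponentially small.\<close>
  define M where "M = 12 * (pi / (2 * \<epsilon>)) + 1"
  define \<delta> where "\<delta> = exp (- M) / real n ^ 3"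
  have \<delta>: "\<delta> > 0"
    using n by (simp add: \<delta>_def)
  have "ln \<delta> = - M + ln (1 / real n ^ 3)"
    using n unfolding \<delta>_def by (simp add: ln_div)
  moreover have "ln (1 / real n ^ 3) \<le> ln (1 / real n ^ 3 + \<delta>)"
    using n \<delta> by (subst ln_le_cancel_iff) (auto intro: add_pos_pos)
  ultimately have "M \<le> ln (1 / real n ^ 3 + \<delta>) - ln \<delta>"
    by linarith
  then have "M / 12 \<le> (ln (1 / real n ^ 3 + \<delta>) - ln \<delta>) / 12"
    by (rule divide_right_mono) simp
  also note regularised_weight_integral_ge[OF \<alpha> n \<delta>]
  also note bound[OF \<delta>]
  finally have "M / 12 \<le> pi / (2 * \<epsilon>)" .
  then show False
    by (simp add: M_def)
qed

section \<open>The criticality threshold\<close>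

theorem theorem1p1:
  fixes \<alpha> :: real
  assumes "\<alpha> > 0"
  shows "critical (frac_laplacian \<alpha>) \<longleftrightarrow> \<alpha> \<ge> 3 / 2"
proof
  assume crit: "critical (frac_laplacian \<alpha>)"
  show "\<alpha> \<ge> 3 / 2"
  proof (rule ccontr)
    assume "\<not> \<alpha> \<ge> 3 / 2"
    then obtain c where "c > 0"
      "\<And>u. finsupp u \<Longrightarrow> c * (cmod (Rep_ell2 u 1))\<^sup>2 \<le> inner u (frac_laplacian \<alpha> u)"
      using frac_laplacian_hardy[of \<alpha>] assms by (metis not_le)
    then show False
      using not_criticalI[of c 1 "frac_laplacian \<alpha>"] crit by simp
  qed
next
  assume \<alpha>: "\<alpha> \<ge> 3 / 2"
  show "critical (frac_laplacian \<alpha>)"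
  proof (rule criticalI)
    show "selfadjoint (frac_laplacian \<alpha>)"
      unfolding frac_laplacian_def
      by (intro selfadjoint_fun_calc continuous_on_powr_nonneg assms)
  qed (rule frac_laplacian_small_energy[OF \<alpha>])
qed

end
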